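(* Let $\mathcal{A}=\mathcal{A}(S_q^2)$ be the coordinate algebra over $\mathbb{C}$ of the standard Podleś quantum sphere ($0<q<1$), let $\sigma$ be its automorphism $\sigma(A)=A$, $\sigma(B)=q^2B$, $\sigma(B^* )=q^{-2}B^*$, let $\tau$ be the $\sigma$-twisted cyclic 2-cocycle $$\tau(a_0,a_1,a_2)=h\big(a_0[(a_1\triangleleft F)(a_2\triangleleft E)-q^2(a_1\triangleleft E)(a_2\triangleleft F)]\big),$$ and let $h_A$ be the $\sigma$-twisted cyclic 0-cocycle defined in the context. Then $[\tau]=\beta\,[Sh_A]$ in $HC^2_\sigma(\mathcal{A})$ for some nonzero $\beta\in\mathbb{C}$.
   Context: $\mathcal{A}(SU_q(2))$ is the unital $*$-algebra over $\mathbb{C}$ generated by $a,c$ with relations $a^*a+c^*c=1$, $aa^*+q^2c^*c=1$, $c^*c=cc^*$, $ac=qca$, $ac^*=qc^*a$. The elements $A=c^*c$, $B=ac$, $B^*=c^*a^*$ generate the subalgebra $\mathcal{A}(S_q^2)$, which is the unital algebra with generators $A,B,B^*$ and relations $BA=q^2AB$, $AB^*=q^2B^*A$, $B^*B=A-A^2$, $BB^*=q^2A-q^4A^2$. A vector space basis consists of the monomials $A^rB^s$ ($r,s\ge0$) and $A^r(B^* )^{s}$ ($r\ge0$, $s\ge1$). Right action of $U_q(su(2))$ (generators $E,F,K^{\pm1}$) on $\mathcal{A}(SU_q(2))$: on generators, $a\triangleleft K=q^{-1/2}a$, $a^*\triangleleft K=q^{1/2}a^*$, $c\triangleleft K=q^{1/2}c$,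 $c^*\triangleleft K=q^{-1/2}c^*$; $a\triangleleft E=0$, $c\triangleleft E=a$, $a^*\triangleleft E=-qc^*$, $c^*\triangleleft E=0$; $a\triangleleft F=c$, $c\triangleleft F=0$, $a^*\triangleleft F=0$, $c^*\triangleleft F=-q^{-1}a^*$; $1\triangleleft K=1$, $1\triangleleft E=1\triangleleft F=0$; and on products $(xy)\triangleleft K=(x\triangleleft K)(y\triangleleft K)$, $(xy)\triangleleft X=(x\triangleleft X)(y\triangleleft K)+(x\triangleleft K^{-1})(y\triangleleft X)$ for $X=E,F$. The algebra $\mathcal{A}(S_q^2)$ is the subalgebra of elements invariant under $K$. $h$ is the Haar state of $\mathcal{A}(SU_q(2))$. The argument of $h$ in the definition of $\tau$ lies in $\mathcal{A}(S_q^2)$ for $a_0,a_1,a_2\in\mathcal{A}(S_q^2)$, and on $\mathcal{A}(S_q^2)$ one has $h(A^rB^s)=0=h(A^r(B^* )^s)$ for $s>0$ and $h(A^r)=(1-q^2)(1-q^{2r+2})^{-1}$. $h_A:\mathcal{A}(S_q^2)\to\mathbb{C}$ is the linear functional with $h_A(A^rB^s)=0=h_A(A^r(B^* )^s)$ for $s>0$, $h_A(1)=0$, and $h_A(A^{r+1})=(1-q^4)(1-q^{2r+4})^{-1}$ for $r\ge0$. It satisfies $h_A(xy)=h_A(\sigma(y)x)$. Twisted cyclic cohomology $HC^*_\sigma(\mathcal{A})$: the cohomology of the complex of linear functionals $\phi:\mathcal{A}^{\otimes(n+1)}\to\mathbb{C}$ with $\phi(a_0,\dots,a_n)=(-1)^n\phi(\sigma(a_n),a_0,\dots,a_{n-1})$,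 with coboundary $(b_\sigma\phi)(a_0,\dots,a_{n+1})=\sum_{j=0}^n(-1)^j\phi(a_0,\dots,a_ja_{j+1},\dots,a_{n+1})+(-1)^{n+1}\phi(\sigma(a_{n+1})a_0,a_1,\dots,a_n)$. For a twisted cyclic 0-cocycle $\phi$, the periodicity operator $S$ is given by $(S\phi)(a_0,a_1,a_2)=\phi(a_0a_1a_2)$, a twisted cyclic 2-cocycle. *)

theory Defs
  imports Complex_Main "HOL-Library.Poly_Mapping" "HOL-Library.Product_Plus"
begin

section \<open>Free algebras and presentations\<close>

text \<open>Words are wrapped in a datatype so that they form an additive monoid under concatenation;
  finitely supported functions on words then form the free unital algebra, with the convolution
  product of \<^theory>\<open>HOL-Library.Poly_Mapping\<close>.\<close>

datatype 'g word = Word (letters: "'g list")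

instantiation word :: (type) monoid_add
begin

definition zero_word :: "'a word" where "0 = Word []"

definition plus_word :: "'a word \<Rightarrow> 'a word \<Rightarrow> 'a word" where
  "v + w = Word (letters v @ letters w)"

instance
  by standard (simp_all add: zero_word_def plus_word_def)

end

type_synonym 'g free_algebra = "'g word \<Rightarrow>\<^sub>0 complex"

text \<open>The product monoid gives the tensor square of the free algebra, with
  \<open>single (v, w) 1\<close> standing for \<open>v \<otimes> w\<close>.\<close>

type_synonym 'g free_tensor = "('g word \<times> 'g word) \<Rightarrow>\<^sub>0 complex"

definition letter :: "'g \<Rightarrow> 'g free_algebra" where
  "letter g = Poly_Mapping.single (Word [g]) 1"

definition const :: "complex \<Rightarrow> 'm::monoid_add \<Rightarrow>\<^sub>0 complex" where
  "const z = Poly_Mapping.single 0 z"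

definition tensor :: "'g free_algebra \<Rightarrow> 'g free_algebra \<Rightarrow> 'g free_tensor" where
  "tensor x y = (\<Sum>v\<in>Poly_Mapping.keys x. \<Sum>w\<in>Poly_Mapping.keys y.
     Poly_Mapping.single (v, w) (Poly_Mapping.lookup x v * Poly_Mapping.lookup y w))"

text \<open>The unital algebra homomorphism out of the free algebra with prescribed values \<open>f\<close> on the
  letters; \<open>scale\<close> is the scalar multiplication of the target.\<close>

definition free_lift ::
  "(complex \<Rightarrow> 'a \<Rightarrow> 'a) \<Rightarrow> ('g \<Rightarrow> 'a::ring_1) \<Rightarrow> 'g free_algebra \<Rightarrow> 'a" where
  "free_lift scale f x =
     (\<Sum>w\<in>Poly_Mapping.keys x. scale (Poly_Mapping.lookup x w) (prod_list (map f (letters w))))"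

inductive_set two_sided_ideal :: "'a::ring_1 set \<Rightarrow> 'a set" for R :: "'a set" where
  zero: "0 \<in> two_sided_ideal R"
| gen: "r \<in> R \<Longrightarrow> x * r * y \<in> two_sided_ideal R"
| add: "x \<in> two_sided_ideal R \<Longrightarrow> y \<in> two_sided_ideal R \<Longrightarrow> x + y \<in> two_sided_ideal R"

inductive_set generated_subalgebra ::
  "(complex \<Rightarrow> 'a \<Rightarrow> 'a) \<Rightarrow> 'a::ring_1 set \<Rightarrow> 'a set"
  for scale :: "complex \<Rightarrow> 'a \<Rightarrow> 'a" and G :: "'a set" where
  one: "1 \<in> generated_subalgebra scale G"
| gen: "g \<in> G \<Longrightarrow> g \<in> generated_subalgebra scale G"
| add: "x \<in> generated_subalgebra scale G \<Longrightarrow> y \<in> generated_subalgebra scale G \<Longrightarrow>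
    x + y \<in> generated_subalgebra scale G"
| mult: "x \<in> generated_subalgebra scale G \<Longrightarrow> y \<in> generated_subalgebra scale G \<Longrightarrow>
    x * y \<in> generated_subalgebra scale G"
| scale: "x \<in> generated_subalgebra scale G \<Longrightarrow> scale z x \<in> generated_subalgebra scale G"


section \<open>The algebra of quantum SU(2)\<close>

text \<open>\<open>Ga'\<close> and \<open>Gc'\<close> are the letters for \<open>a\<^sup>*\<close> and \<open>c\<^sup>*\<close>.\<close>

datatype su2_gen = Ga | Ga' | Gc | Gc'

primrec su2_value :: "('a \<Rightarrow> 'a) \<Rightarrow> 'a \<Rightarrow> 'a \<Rightarrow> su2_gen \<Rightarrow> 'a" where
  "su2_value star a c Ga = a"
| "su2_value star a c Ga' = star a"
| "su2_value star a c Gc = c"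
| "su2_value star a c Gc' = star c"

text \<open>The first five relators are the defining relations. Since a \<open>*\<close>-algebra is being presented,
  the adjoints of the relators are included; the first three are self-adjoint.\<close>

definition su2_relators :: "real \<Rightarrow> su2_gen free_algebra set" where
  "su2_relators q =
    {letter Ga' * letter Ga + letter Gc' * letter Gc - 1,
     letter Ga * letter Ga' + const (of_real (q^2)) * letter Gc' * letter Gc - 1,
     letter Gc' * letter Gc - letter Gc * letter Gc',
     letter Ga * letter Gc - const (of_real q) * letter Gc * letter Ga,
     letter Ga * letter Gc' - const (of_real q) * letter Gc' * letter Ga,
     letter Gc' * letter Ga' - const (of_real q) * letter Ga' * letter Gc',
     letter Gc * letter Ga' - const (of_real q) * letter Ga' * letter Gc}"

text \<open>\<open>'a\<close> is the \<open>*\<close>-algebra presented by the generators and relations above: evaluation of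
  noncommutative polynomials is onto, and its kernel is generated by the relators.\<close>

locale quantum_SU2 = vector_space scale
  for scale :: "complex \<Rightarrow> 'a::ring_1 \<Rightarrow> 'a" +
  fixes q :: real and star :: "'a \<Rightarrow> 'a" and a c :: 'a
  assumes q_pos: "0 < q" and q_less_1: "q < 1"
    and scale_mult_left: "scale z x * y = scale z (x * y)"
    and scale_mult_right: "x * scale z y = scale z (x * y)"
    and star_add: "star (x + y) = star x + star y"
    and star_scale: "star (scale z x) = scale (cnj z) (star x)"
    and star_mult: "star (x * y) = star y * star x"
    and star_star: "star (star x) = x"
    and generated: "surj (free_lift scale (su2_value star a c))"
    and relations: "{x. free_lift scale (su2_value star a c) x = 0} = two_sided_ideal (su2_relators q)"


section \<open>The right action of the quantised enveloping algebra\<close>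

text \<open>\<open>UKi\<close> stands for \<open>K\<^sup>-\<^sup>1\<close>, and \<open>act X x\<close> for \<open>x \<triangleleft> X\<close>.\<close>

datatype uq_gen = UK | UKi | UE | UF

locale Uq_right_action = quantum_SU2 scale q star a c
  for scale :: "complex \<Rightarrow> 'a::ring_1 \<Rightarrow> 'a" and q star a c +
  fixes act :: "uq_gen \<Rightarrow> 'a \<Rightarrow> 'a"
  assumes act_linear: "Vector_Spaces.linear scale scale (act X)"
    and act_Ki_K: "act UKi (act UK x) = x" and act_K_Ki: "act UK (act UKi x) = x"
    and act_K_a: "act UK a = scale (of_real (1 / sqrt q)) a"
    and act_K_a': "act UK (star a) = scale (of_real (sqrt q)) (star a)"
    and act_K_c: "act UK c = scale (of_real (sqrt q)) c"
    and act_K_c': "act UK (star c) = scale (of_real (1 / sqrt q)) (star c)"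
    and act_E_a: "act UE a = 0"
    and act_E_c: "act UE c = a"
    and act_E_a': "act UE (star a) = scale (- of_real q) (star c)"
    and act_E_c': "act UE (star c) = 0"
    and act_F_a: "act UF a = c"
    and act_F_c: "act UF c = 0"
    and act_F_a': "act UF (star a) = 0"
    and act_F_c': "act UF (star c) = scale (- of_real (1 / q)) (star a)"
    and act_K_1: "act UK 1 = 1" and act_E_1: "act UE 1 = 0" and act_F_1: "act UF 1 = 0"
    and act_K_mult: "act UK (x * y) = act UK x * act UK y"
    and act_E_mult: "act UE (x * y) = act UE x * act UK y + act UKi x * act UE y"
    and act_F_mult: "act UF (x * y) = act UF x * act UK y + act UKi x * act UF y"


section \<open>The Haar state\<close>

text \<open>The coproduct is the one for which the matrix with rows \<open>(a, -q c\<^sup>*)\<close> and \<open>(c, a\<^sup>*)\<close> is a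
  corepresentation, lifted to the free algebra. It is the coproduct for which the right action is
  \<open>x \<triangleleft> X = \<langle>X, x\<^sub>(\<^sub>1\<^sub>)\<rangle> x\<^sub>(\<^sub>2\<^sub>)\<close>.\<close>

primrec su2_coproduct_gen :: "real \<Rightarrow> su2_gen \<Rightarrow> su2_gen free_tensor" where
  "su2_coproduct_gen q Ga =
     tensor (letter Ga) (letter Ga) - const (of_real q) * tensor (letter Gc') (letter Gc)"
| "su2_coproduct_gen q Ga' =
     tensor (letter Ga') (letter Ga') - const (of_real q) * tensor (letter Gc) (letter Gc')"
| "su2_coproduct_gen q Gc = tensor (letter Gc) (letter Ga) + tensor (letter Ga') (letter Gc)"
| "su2_coproduct_gen q Gc' = tensor (letter Gc') (letter Ga') + tensor (letter Ga) (letter Gc')"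

definition su2_coproduct :: "real \<Rightarrow> su2_gen free_algebra \<Rightarrow> su2_gen free_tensor" where
  "su2_coproduct q = free_lift (\<lambda>z t. const z * t) (su2_coproduct_gen q)"

text \<open>The slice maps \<open>id \<otimes> h\<close> and \<open>h \<otimes> id\<close>, composed with the evaluation \<open>ev\<close> of words.\<close>

definition slice_right ::
  "(complex \<Rightarrow> 'a \<Rightarrow> 'a) \<Rightarrow> ('g word \<Rightarrow> 'a) \<Rightarrow> ('a \<Rightarrow> complex) \<Rightarrow> 'g free_tensor \<Rightarrow> 'a::ring_1" where
  "slice_right scale ev h t =
     (\<Sum>(v, w)\<in>Poly_Mapping.keys t. scale (Poly_Mapping.lookup t (v, w) * h (ev w)) (ev v))"

definition slice_left ::
  "(complex \<Rightarrow> 'a \<Rightarrow> 'a) \<Rightarrow> ('g word \<Rightarrow> 'a) \<Rightarrow> ('a \<Rightarrow> complex) \<Rightarrow> 'g free_tensor \<Rightarrow> 'a::ring_1" where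
  "slice_left scale ev h t =
     (\<Sum>(v, w)\<in>Poly_Mapping.keys t. scale (Poly_Mapping.lookup t (v, w) * h (ev v)) (ev w))"

definition su2_word :: "('a::ring_1 \<Rightarrow> 'a) \<Rightarrow> 'a \<Rightarrow> 'a \<Rightarrow> su2_gen word \<Rightarrow> 'a" where
  "su2_word star a c w = prod_list (map (su2_value star a c) (letters w))"

locale haar_state = quantum_SU2 scale q star a c
  for scale :: "complex \<Rightarrow> 'a::ring_1 \<Rightarrow> 'a" and q star a c +
  fixes h :: "'a \<Rightarrow> complex"
  assumes haar_linear: "Vector_Spaces.linear scale (*) h"
    and haar_one: "h 1 = 1"
    and haar_positive: "h (star x * x) \<in> \<real>" "0 \<le> Re (h (star x * x))"
    and haar_invariant_right:
      "slice_right scale (su2_word star a c) h (su2_coproduct q p) =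
         scale (h (free_lift scale (su2_value star a c) p)) 1"
    and haar_invariant_left:
      "slice_left scale (su2_word star a c) h (su2_coproduct q p) =
         scale (h (free_lift scale (su2_value star a c) p)) 1"


section \<open>The standard Podles sphere\<close>

definition podles_A :: "('a::ring_1 \<Rightarrow> 'a) \<Rightarrow> 'a \<Rightarrow> 'a" where
  "podles_A star c = star c * c"

definition podles_B :: "'a::ring_1 \<Rightarrow> 'a \<Rightarrow> 'a" where
  "podles_B a c = a * c"

definition podles_algebra ::
  "(complex \<Rightarrow> 'a \<Rightarrow> 'a) \<Rightarrow> ('a \<Rightarrow> 'a) \<Rightarrow> 'a \<Rightarrow> 'a \<Rightarrow> 'a::ring_1 set" where
  "podles_algebra scale star a c =
     generated_subalgebra scale {podles_A star c, podles_B a c, star (podles_B a c)}"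

definition algebra_automorphism_on ::
  "(complex \<Rightarrow> 'a \<Rightarrow> 'a) \<Rightarrow> 'a::ring_1 set \<Rightarrow> ('a \<Rightarrow> 'a) \<Rightarrow> bool" where
  "algebra_automorphism_on scale S \<sigma> \<longleftrightarrow>
     bij_betw \<sigma> S S \<and> \<sigma> 1 = 1 \<and>
     (\<forall>x\<in>S. \<forall>y\<in>S. \<sigma> (x + y) = \<sigma> x + \<sigma> y \<and> \<sigma> (x * y) = \<sigma> x * \<sigma> y) \<and>
     (\<forall>z. \<forall>x\<in>S. \<sigma> (scale z x) = scale z (\<sigma> x))"

definition linear_functional_on ::
  "(complex \<Rightarrow> 'a \<Rightarrow> 'a) \<Rightarrow> 'a::ring_1 set \<Rightarrow> ('a \<Rightarrow> complex) \<Rightarrow> bool" where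
  "linear_functional_on scale S f \<longleftrightarrow>
     (\<forall>x\<in>S. \<forall>y\<in>S. f (x + y) = f x + f y) \<and> (\<forall>z. \<forall>x\<in>S. f (scale z x) = z * f x)"

text \<open>The automorphism \<open>\<sigma>\<close> and the functional \<open>hA\<close> are constrained on the Podles subalgebra only.\<close>

definition is_podles_sigma ::
  "(complex \<Rightarrow> 'a \<Rightarrow> 'a) \<Rightarrow> real \<Rightarrow> ('a \<Rightarrow> 'a) \<Rightarrow> 'a \<Rightarrow> 'a \<Rightarrow> ('a::ring_1 \<Rightarrow> 'a) \<Rightarrow> bool" where
  "is_podles_sigma scale q star a c \<sigma> \<longleftrightarrow>
     algebra_automorphism_on scale (podles_algebra scale star a c) \<sigma> \<and>
     \<sigma> (podles_A star c) = podles_A star c \<and>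
     \<sigma> (podles_B a c) = scale (of_real (q^2)) (podles_B a c) \<and>
     \<sigma> (star (podles_B a c)) = scale (of_real (1 / q^2)) (star (podles_B a c))"

definition is_podles_hA ::
  "(complex \<Rightarrow> 'a \<Rightarrow> 'a) \<Rightarrow> real \<Rightarrow> ('a \<Rightarrow> 'a) \<Rightarrow> 'a \<Rightarrow> 'a \<Rightarrow> ('a::ring_1 \<Rightarrow> complex) \<Rightarrow> bool" where
  "is_podles_hA scale q star a c hA \<longleftrightarrow>
     linear_functional_on scale (podles_algebra scale star a c) hA \<and>
     (\<forall>r s. 0 < s \<longrightarrow>
        hA (podles_A star c ^ r * podles_B a c ^ s) = 0 \<and>
        hA (podles_A star c ^ r * star (podles_B a c) ^ s) = 0) \<and>
     hA 1 = 0 \<and>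
     (\<forall>r. hA (podles_A star c ^ (r + 1)) = of_real ((1 - q^4) / (1 - q^(2 * r + 4))))"


section \<open>Twisted cyclic cohomology\<close>

text \<open>An \<open>n\<close>-cochain is a function on lists, of which only the values on lists of length \<open>n + 1\<close>
  with entries in the algebra \<open>S\<close> are relevant. A linear functional on \<open>S\<^sup>\<otimes>\<^sup>(\<^sup>n\<^sup>+\<^sup>1\<^sup>)\<close> is a function
  of \<open>n + 1\<close> arguments which is linear in each of them.\<close>

definition tuples :: "'a set \<Rightarrow> nat \<Rightarrow> 'a list set" where
  "tuples S n = {as. length as = n + 1 \<and> set as \<subseteq> S}"

definition multilinear_on ::
  "(complex \<Rightarrow> 'a \<Rightarrow> 'a) \<Rightarrow> 'a::ring_1 set \<Rightarrow> nat \<Rightarrow> ('a list \<Rightarrow> complex) \<Rightarrow> bool" where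
  "multilinear_on scale S n \<phi> \<longleftrightarrow>
     (\<forall>as\<in>tuples S n. \<forall>i\<le>n. linear_functional_on scale S (\<lambda>x. \<phi> (as[i := x])))"

definition cyclic_cochains ::
  "(complex \<Rightarrow> 'a \<Rightarrow> 'a) \<Rightarrow> 'a::ring_1 set \<Rightarrow> ('a \<Rightarrow> 'a) \<Rightarrow> nat \<Rightarrow> ('a list \<Rightarrow> complex) set" where
  "cyclic_cochains scale S \<sigma> n =
     {\<phi>. multilinear_on scale S n \<phi> \<and>
          (\<forall>as\<in>tuples S n. \<phi> as = (-1)^n * \<phi> (\<sigma> (last as) # butlast as))}"

text \<open>For \<open>as = [a\<^sub>0, \<dots>, a\<^sub>n\<^sub>+\<^sub>1]\<close>; the last term involves \<open>[\<sigma>(a\<^sub>n\<^sub>+\<^sub>1) a\<^sub>0, a\<^sub>1, \<dots>, a\<^sub>n]\<close>.\<close>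

definition twisted_coboundary ::
  "('a::ring_1 \<Rightarrow> 'a) \<Rightarrow> nat \<Rightarrow> ('a list \<Rightarrow> complex) \<Rightarrow> 'a list \<Rightarrow> complex" where
  "twisted_coboundary \<sigma> n \<phi> as =
     (\<Sum>j\<le>n. (-1)^j * \<phi> (take j as @ [as ! j * as ! (j + 1)] @ drop (j + 2) as)) +
     (-1)^(n + 1) * \<phi> ((\<sigma> (as ! (n + 1)) * as ! 0) # take n (drop 1 as))"

definition cyclic_cocycles ::
  "(complex \<Rightarrow> 'a \<Rightarrow> 'a) \<Rightarrow> 'a::ring_1 set \<Rightarrow> ('a \<Rightarrow> 'a) \<Rightarrow> nat \<Rightarrow> ('a list \<Rightarrow> complex) set" where
  "cyclic_cocycles scale S \<sigma> n =
     {\<phi> \<in> cyclic_cochains scale S \<sigma> n. \<forall>as\<in>tuples S (n + 1). twisted_coboundary \<sigma> n \<phi> as = 0}"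

definition cyclic_coboundaries ::
  "(complex \<Rightarrow> 'a \<Rightarrow> 'a) \<Rightarrow> 'a::ring_1 set \<Rightarrow> ('a \<Rightarrow> 'a) \<Rightarrow> nat \<Rightarrow> ('a list \<Rightarrow> complex) set" where
  "cyclic_coboundaries scale S \<sigma> n =
     {\<phi>. case n of
            0 \<Rightarrow> \<forall>as\<in>tuples S 0. \<phi> as = 0
          | Suc m \<Rightarrow> \<exists>\<theta>\<in>cyclic_cochains scale S \<sigma> m.
              \<forall>as\<in>tuples S n. \<phi> as = twisted_coboundary \<sigma> m \<theta> as}"

definition cohomologous ::
  "(complex \<Rightarrow> 'a \<Rightarrow> 'a) \<Rightarrow> 'a::ring_1 set \<Rightarrow> ('a \<Rightarrow> 'a) \<Rightarrow> nat \<Rightarrow>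
    (('a list \<Rightarrow> complex) \<times> ('a list \<Rightarrow> complex)) set" where
  "cohomologous scale S \<sigma> n =
     {(\<phi>, \<psi>). \<phi> \<in> cyclic_cocycles scale S \<sigma> n \<and> \<psi> \<in> cyclic_cocycles scale S \<sigma> n \<and>
        (\<lambda>as. \<phi> as - \<psi> as) \<in> cyclic_coboundaries scale S \<sigma> n}"

text \<open>The class of a cocycle in the quotient of the cocycles by \<^const>\<open>cohomologous\<close>.\<close>

definition HC_class ::
  "(complex \<Rightarrow> 'a \<Rightarrow> 'a) \<Rightarrow> 'a::ring_1 set \<Rightarrow> ('a \<Rightarrow> 'a) \<Rightarrow> nat \<Rightarrow> ('a list \<Rightarrow> complex) \<Rightarrow>
    ('a list \<Rightarrow> complex) set" where
  "HC_class scale S \<sigma> n \<phi> = cohomologous scale S \<sigma> n `` {\<phi>}"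

definition periodicity :: "('a::ring_1 list \<Rightarrow> complex) \<Rightarrow> 'a list \<Rightarrow> complex" where
  "periodicity \<phi> as = \<phi> [as ! 0 * as ! 1 * as ! 2]"

definition cochain0 :: "('a \<Rightarrow> complex) \<Rightarrow> 'a list \<Rightarrow> complex" where
  "cochain0 f as = f (as ! 0)"

definition podles_tau ::
  "(complex \<Rightarrow> 'a \<Rightarrow> 'a) \<Rightarrow> real \<Rightarrow> (uq_gen \<Rightarrow> 'a \<Rightarrow> 'a) \<Rightarrow> ('a::ring_1 \<Rightarrow> complex) \<Rightarrow>
    'a list \<Rightarrow> complex" where
  "podles_tau scale q act h as =
     h (as ! 0 * (act UF (as ! 1) * act UE (as ! 2)
                  - scale (of_real (q^2)) (act UE (as ! 1) * act UF (as ! 2))))"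

end

theory Submission
  imports Defs "HOL-Computational_Algebra.Polynomial" "HOL-Library.Function_Algebras"
begin

text \<open>Write \<open>S\<close> for the Podles sphere, \<open>\<partial>\<^sub>E x = x \<triangleleft> E\<close> and \<open>\<partial>\<^sub>F x = x \<triangleleft> F\<close>. On \<open>S\<close> these are derivations into the
algebra of quantum \<open>SU(2)\<close>, and if \<open>c\<close> were invertible they would be inner: \<open>\<partial>\<^sub>E x\<close> would be a
multiple of the commutator of \<open>x\<close> with \<open>c\<^sup>-\<^sup>1 a\<close>, and \<open>\<partial>\<^sub>F x\<close> a multiple of the commutator with
\<open>a\<^sup>* c\<^sup>*\<^sup>-\<^sup>1\<close>. A cocycle \<open>h(x (\<partial>\<^sub>F y \<partial>\<^sub>E z - \<dots>))\<close> built from inner derivations is a Hochschild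
coboundary: replace one of the derivations by the element that implements it.

Two observations turn this into an argument inside the algebra. First, multiplying by \<open>A\<close> clears the
denominators: with \<open>e = c\<^sup>* a\<close> and \<open>f = a\<^sup>* c\<close> one has \<open>e \<sigma>(y) - y e = k\<^sub>E \<partial>\<^sub>E(y) A\<close> and
\<open>f \<sigma>(y) - y f = k\<^sub>F \<partial>\<^sub>F(y) A\<close> for all \<open>y\<close> in \<open>S\<close> (\<open>E_commutator\<close>, \<open>F_commutator\<close>). Second, the
functional \<open>x \<mapsto> h(x A\<^sup>-\<^sup>1)\<close>, which then has to replace \<open>h\<close>, exists after a regularisation. On
polynomials in \<open>A\<close> the Haar state is \<open>h(p(A)) = (1 - q\<^sup>2) (\<Sum>k. q\<^sup>2\<^sup>k p(q\<^sup>2\<^sup>k))\<close>; the sum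
\<open>\<Sum>k. p(q\<^sup>2\<^sup>k)\<close> diverges if \<open>p(0) \<noteq> 0\<close>, but \<open>Tr p(A) = (\<Sum>k. p(q\<^sup>2\<^sup>k) - p(0))\<close> makes sense. This \<open>Tr\<close>, extended by
\<open>0\<close> to the monomials that contain \<open>B\<close> or \<open>B\<^sup>*\<close>, is a trace on \<open>S\<close> with \<open>Tr(x A) = h(x) / (1 - q\<^sup>2)\<close>
(\<open>Tr_commute\<close>, \<open>Tr_mult_A\<close>). Consequently
\<open>\<psi>(x, y) = q\<^sup>3\<^sup>/\<^sup>2 Tr(x (\<partial>\<^sub>E(y) f - q \<partial>\<^sub>F(y) e))\<close> satisfies \<open>b\<^sub>\<sigma> \<psi> = \<tau>\<close> (\<open>coboundary_\<psi>\<close>).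

The cochain \<open>\<psi>\<close> is not cyclic, and its failure to be so is exactly where \<open>h\<^sub>A\<close> enters. The invariance of
\<open>h\<close> gives \<open>\<tau>(1, x, y) = 0\<close>, from which \<open>\<psi>(x, y) + \<psi>(\<sigma>(y), x) = \<phi>(x y)\<close> for a functional \<open>\<phi>\<close> on \<open>S\<close>.
It is a \<open>\<sigma>\<close>-twisted trace, and such traces are determined by their values at \<open>1\<close> and \<open>A\<close>
(\<open>twisted_trace_unique\<close>). Comparing these values yields \<open>\<phi> = 2 \<beta> h\<^sub>A\<close> with \<open>\<beta> = q\<^sup>2 / (1 - q\<^sup>4)\<close>
(\<open>\<phi>_eq\<close>). Now the image \<open>\<eta>(x, y, z) = h\<^sub>A(x y z)\<close> of \<open>h\<^sub>A\<close> under the periodicity operator is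
the Hochschild coboundary of \<open>(x, y) \<mapsto> h\<^sub>A(x y)\<close>, so \<open>\<theta>(x, y) = \<psi>(x, y) - \<beta> h\<^sub>A(x y)\<close> is a cyclic
1-cochain with \<open>b\<^sub>\<sigma> \<theta> = \<tau> - \<beta> \<eta>\<close>. In particular \<open>\<tau>\<close> is a cyclic cocycle, because \<open>b\<^sub>\<sigma> \<theta>\<close> and \<open>\<eta>\<close> are.

The values of \<open>h\<close> on \<open>S\<close> follow from \<open>h(x \<triangleleft> E) = 0\<close> and \<open>h(x\<^sup>*) = cnj (h x)\<close> (\<open>haar_EF\<close>, \<open>haar_star\<close>, \<open>haar_A\<close>,
\<open>haar_A_B\<close>). They contain
enough information to show that the powers of \<open>A\<close> are linearly independent modulo the other monomials,
which is what the definition of \<open>Tr\<close> needs (\<open>functional_exists\<close>).\<close>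

section \<open>Evaluation of words and the defining relations\<close>

lemma sum_keys_superset:
  fixes p :: "'k \<Rightarrow>\<^sub>0 complex" and f :: "'k \<Rightarrow> complex \<Rightarrow> 'a::ab_group_add"
  assumes "finite K" "Poly_Mapping.keys p \<subseteq> K" "\<And>k. f k 0 = 0"
  shows "(\<Sum>k\<in>Poly_Mapping.keys p. f k (Poly_Mapping.lookup p k)) = (\<Sum>k\<in>K. f k (Poly_Mapping.lookup p k))"
  by (rule sum.mono_neutral_left) (use assms in \<open>auto simp: in_keys_iff\<close>)

lemma sum_keys_add:
  fixes p r :: "'k \<Rightarrow>\<^sub>0 complex" and f :: "'k \<Rightarrow> complex \<Rightarrow> 'a::ab_group_add"
  assumes "\<And>k. f k 0 = 0" "\<And>k x y. f k (x + y) = f k x + f k y"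
  shows "(\<Sum>k\<in>Poly_Mapping.keys (p + r). f k (Poly_Mapping.lookup (p + r) k)) =
    (\<Sum>k\<in>Poly_Mapping.keys p. f k (Poly_Mapping.lookup p k)) +
    (\<Sum>k\<in>Poly_Mapping.keys r. f k (Poly_Mapping.lookup r k))"
proof -
  let ?K = "Poly_Mapping.keys p \<union> Poly_Mapping.keys r"
  let ?S = "\<lambda>t K. \<Sum>k\<in>K. f k (Poly_Mapping.lookup t k)"
  have "?S (p + r) (Poly_Mapping.keys (p + r)) = ?S (p + r) ?K"
    by (rule sum_keys_superset) (use assms(1) Poly_Mapping.keys_add[of p r] in auto)
  also have "\<dots> = ?S p ?K + ?S r ?K" by (simp add: lookup_add assms(2) sum.distrib)
  also have "?S p ?K = ?S p (Poly_Mapping.keys p)"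
    by (rule sum_keys_superset[symmetric]) (use assms(1) in auto)
  also have "?S r ?K = ?S r (Poly_Mapping.keys r)"
    by (rule sum_keys_superset[symmetric]) (use assms(1) in auto)
  finally show ?thesis .
qed

lemma letter_mult [simp]:
  "letter x * letter y = Poly_Mapping.single (Word [x, y]) 1"
  "const z * letter x = Poly_Mapping.single (Word [x]) z"
  "Poly_Mapping.single (Word u) z * letter y = Poly_Mapping.single (Word (u @ [y])) z"
  "const z * Poly_Mapping.single (Word u) k = Poly_Mapping.single (Word u) (z * k)"
  by (simp_all add: letter_def const_def mult_single plus_word_def zero_word_def)

context quantum_SU2
begin

notation scale (infixr \<open>*s\<close> 75)

abbreviation "ev \<equiv> su2_word star a c"
abbreviation "free_ev \<equiv> free_lift scale (su2_value star a c)"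
abbreviation "Q \<equiv> complex_of_real q"
abbreviation "a' \<equiv> star a"
abbreviation "c' \<equiv> star c"

lemma q_neq_0 [simp]: "q \<noteq> 0"
  using q_pos by simp

lemma ev_Nil: "ev (Word []) = 1" and ev_Cons: "ev (Word (g # u)) = su2_value star a c g * ev (Word u)"
  by (simp_all add: su2_word_def)

lemma free_ev_alt: "free_ev p = (\<Sum>w\<in>Poly_Mapping.keys p. Poly_Mapping.lookup p w *s ev w)"
  by (simp add: free_lift_def su2_word_def)

lemma free_ev_add: "free_ev (p + r) = free_ev p + free_ev r"
  unfolding free_ev_alt by (rule sum_keys_add) (simp_all add: scale_left_distrib)

lemma free_ev_single: "free_ev (Poly_Mapping.single w z) = z *s ev w"
  by (cases "z = 0") (simp_all add: free_ev_alt)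

lemma free_ev_diff: "free_ev (p - r) = free_ev p - free_ev r"
  using free_ev_add[of "p - r" r] by simp

lemma free_ev_1: "free_ev 1 = 1"
  using free_ev_single[of 0 1] by (simp add: zero_word_def ev_Nil flip: single_one)

lemma relator_vanishes: "r \<in> su2_relators q \<Longrightarrow> free_ev r = 0"
  using relations two_sided_ideal.gen[of r "su2_relators q" 1 1] by auto

lemma su2_relations:
  "a' * a = 1 - c' * c" "a * a' = 1 - Q^2 *s (c' * c)" "c * c' = c' * c"
  "a * c = Q *s (c * a)" "a * c' = Q *s (c' * a)" "a' * c' = (1 / Q) *s (c' * a')"
  "a' * c = (1 / Q) *s (c * a')"
proof -
  note ev = free_ev_add free_ev_diff free_ev_single free_ev_1 ev_Cons ev_Nil
  note rel = relator_vanishes[unfolded su2_relators_def]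
  have "a' * a + c' * c - 1 = 0"
    using rel[of "letter Ga' * letter Ga + letter Gc' * letter Gc - 1"] by (simp add: ev)
  then show "a' * a = 1 - c' * c" by (simp add: eq_diff_eq)
  have "a * a' + Q^2 *s (c' * c) - 1 = 0"
    using rel[of "letter Ga * letter Ga' + const (of_real (q^2)) * letter Gc' * letter Gc - 1"]
    by (simp add: ev)
  then show "a * a' = 1 - Q^2 *s (c' * c)" by (simp add: eq_diff_eq)
  show "c * c' = c' * c" "a * c = Q *s (c * a)" "a * c' = Q *s (c' * a)"
    using rel[of "letter Gc' * letter Gc - letter Gc * letter Gc'"]
      rel[of "letter Ga * letter Gc - const (of_real q) * letter Gc * letter Ga"]
      rel[of "letter Ga * letter Gc' - const (of_real q) * letter Gc' * letter Ga"]
    by (simp_all add: ev)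
  have "c' * a' = Q *s (a' * c')" "c * a' = Q *s (a' * c)"
    using rel[of "letter Gc' * letter Ga' - const (of_real q) * letter Ga' * letter Gc'"]
      rel[of "letter Gc * letter Ga' - const (of_real q) * letter Ga' * letter Gc"]
    by (simp_all add: ev)
  then show "a' * c' = (1 / Q) *s (c' * a')" "a' * c = (1 / Q) *s (c * a')"
    by simp_all
qed

text \<open>Together with associativity, the relations become rewrite rules that move \<open>c\<^sup>*\<close> and \<open>c\<close> to
  the left and cancel neighbouring \<open>a\<close> and \<open>a\<^sup>*\<close>.\<close>

lemma su2_relations_assoc:
  "a' * (a * z) = z - c' * (c * z)" "a * (a' * z) = z - Q^2 *s (c' * (c * z))" "c * (c' * z) = c' * (c * z)"
  "a * (c * z) = Q *s (c * (a * z))" "a * (c' * z) = Q *s (c' * (a * z))"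
  "a' * (c' * z) = (1 / Q) *s (c' * (a' * z))" "a' * (c * z) = (1 / Q) *s (c * (a' * z))"
  using su2_relations[THEN arg_cong, of "\<lambda>x. x * z"]
  by (simp_all add: scale_mult_left left_diff_distrib mult.assoc)

lemmas linear_simps = scale_mult_left scale_mult_right scale_right_distrib scale_right_diff_distrib
  distrib_left distrib_right left_diff_distrib right_diff_distrib mult.assoc

lemmas normal_order = linear_simps su2_relations su2_relations_assoc

lemma word_span: "x \<in> span (range ev)"
proof -
  obtain p where "x = free_ev p" using generated by (metis surjD)
  then show ?thesis unfolding free_ev_alt by (blast intro: span_sum span_scale span_base)
qed

end

section \<open>Invariance of the Haar state under the action\<close>

lemma tensor_letter: "tensor (letter x) (letter y) = Poly_Mapping.single (Word [x], Word [y]) 1"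
  by (simp add: tensor_def letter_def)

lemma const_tensor_single:
  "const z * Poly_Mapping.single (v, w) y = Poly_Mapping.single (v :: 'g word, w :: 'g word) (z * y)"
  by (simp add: const_def mult_single zero_prod_def flip: zero_word_def)

lemma su2_coproduct_word:
  "su2_coproduct q (Poly_Mapping.single (Word u) 1) = prod_list (map (su2_coproduct_gen q) u)"
  by (simp add: su2_coproduct_def free_lift_def const_def)

lemma single_add_induct [case_names zero single]:
  assumes "P 0" "\<And>k z t. P t \<Longrightarrow> P (Poly_Mapping.single k z + t)"
  shows "P t"
proof (induction t rule: Poly_Mapping.update_induct)
  case (update f k z)
  have "Poly_Mapping.update k z f = Poly_Mapping.single k z + f"
    using update.hyps by (intro poly_mapping_eqI) (auto simp: lookup_update lookup_add lookup_single in_keys_iff)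
  then show ?case using assms(2) update.IH by simp
qed (fact assms(1))

text \<open>A linear combination is kept as a list of coefficients and indices, so that the same combination of
words can be evaluated both in the algebra and under a slice map.\<close>

definition lincomb :: "(complex \<Rightarrow> 'b \<Rightarrow> 'b) \<Rightarrow> (complex \<times> 'c) list \<Rightarrow> ('c \<Rightarrow> 'b) \<Rightarrow> 'b::ab_group_add" where
  "lincomb scale L f = (\<Sum>(z, v)\<leftarrow>L. scale z (f v))"

context quantum_SU2
begin

abbreviation "slice \<equiv> slice_right scale ev"

lemma slice_add: "slice g (t + t') = slice g t + slice g t'"
proof -
  have "slice g t = (\<Sum>k\<in>Poly_Mapping.keys t.
      (\<lambda>(v, w) z. (z * g (ev w)) *s ev v) k (Poly_Mapping.lookup t k))" for t
    unfolding slice_right_def by (rule sum.cong) auto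
  then show ?thesis
    by (simp only:) (rule sum_keys_add, auto simp: scale_left_distrib ring_distribs)
qed

lemma slice_single: "slice g (Poly_Mapping.single (v, w) z) = (z * g (ev w)) *s ev v"
  by (cases "z = 0") (simp_all add: slice_right_def)

lemma slice_diff: "slice g (t - t') = slice g t - slice g t'"
  using slice_add[of g "t - t'" t'] by simp

lemma ev_plus: "ev (v + w) = ev v * ev w"
  by (simp add: su2_word_def plus_word_def)

text \<open>This is how the coproduct of a word is sliced letter by letter: the second tensor factor of the first
letter is absorbed into the functional. For this reason the functional \<open>g\<close> stays arbitrary below.\<close>

lemma slice_single_mult:
  "slice g (Poly_Mapping.single (v, w) z * t) = z *s (ev v * slice (\<lambda>x. g (ev w * x)) t)"
proof (induction t rule: single_add_induct)
  case zero
  show ?case by (simp add: slice_right_def)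
next
  case (single k x t)
  have "slice g (Poly_Mapping.single (v, w) z * Poly_Mapping.single k x) =
      z *s (ev v * slice (\<lambda>x. g (ev w * x)) (Poly_Mapping.single k x))"
    by (cases k) (simp add: mult_single slice_single ev_plus scale_mult_right mult.assoc)
  with single show ?case by (simp add: distrib_left slice_add scale_right_distrib)
qed

definition slice_word :: "('a \<Rightarrow> complex) \<Rightarrow> su2_gen list \<Rightarrow> 'a" where
  "slice_word g u = slice g (prod_list (map (su2_coproduct_gen q) u))"

lemma slice_word_Nil: "slice_word g [] = g 1 *s 1"
  using slice_single[of g 0 0 1]
  by (simp add: slice_word_def zero_word_def ev_Nil zero_prod_def flip: single_one)

lemma slice_word_Cons:
  "slice_word g (Ga # u) =
     a * slice_word (\<lambda>x. g (a * x)) u - Q *s (c' * slice_word (\<lambda>x. g (c * x)) u)"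
  "slice_word g (Ga' # u) =
     a' * slice_word (\<lambda>x. g (a' * x)) u - Q *s (c * slice_word (\<lambda>x. g (c' * x)) u)"
  "slice_word g (Gc # u) =
     c * slice_word (\<lambda>x. g (a * x)) u + a' * slice_word (\<lambda>x. g (c * x)) u"
  "slice_word g (Gc' # u) =
     c' * slice_word (\<lambda>x. g (a' * x)) u + a * slice_word (\<lambda>x. g (c' * x)) u"
  by (simp_all add: slice_word_def tensor_letter const_tensor_single distrib_right left_diff_distrib
      slice_add slice_diff slice_single_mult ev_Cons ev_Nil)

lemma lincomb_Nil [simp]: "lincomb scale [] f = 0"
  and lincomb_Cons [simp]: "lincomb scale ((z, v) # L) f = z *s f v + lincomb scale L f"
  by (simp_all add: lincomb_def)

lemma lincomb_mult: "lincomb scale L (\<lambda>v. x * f v) = x * lincomb scale L f"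
  by (induction L) (auto simp: scale_mult_right distrib_left)

lemma lincomb_scale: "lincomb scale L (\<lambda>v. z *s f v) = z *s lincomb scale L f"
  by (induction L) (auto simp: scale_right_distrib mult.commute)

lemma lincomb_add: "lincomb scale L (\<lambda>v. f v + g v) = lincomb scale L f + lincomb scale L g"
  by (induction L) (auto simp: scale_right_distrib)

lemma lincomb_diff: "lincomb scale L (\<lambda>v. f v - g v) = lincomb scale L f - lincomb scale L g"
  by (induction L) (auto simp: scale_right_diff_distrib)

lemma lincomb_map:
  "lincomb scale (map (\<lambda>(z, v). (y * z, k v)) L) f = y *s lincomb scale L (\<lambda>v. f (k v))"
  by (induction L) (auto simp: scale_right_distrib)

end

locale podles_haar = Uq_right_action scale q star a c act + haar_state scale q star a c h
  for scale :: "complex \<Rightarrow> 'a::ring_1 \<Rightarrow> 'a" and q star a c act h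
begin

abbreviation "s \<equiv> complex_of_real (sqrt q)"

lemma s_sq: "Q = s * s"
  using q_pos by (simp flip: of_real_mult)

sublocale act: Vector_Spaces.linear scale scale "act X" for X
  by (rule act_linear)

lemmas h_add = Vector_Spaces.linear.axioms(3)[OF haar_linear, THEN module_hom.add]
  and h_scale = Vector_Spaces.linear.axioms(3)[OF haar_linear, THEN module_hom.scale]
  and h_zero = Vector_Spaces.linear.axioms(3)[OF haar_linear, THEN module_hom.zero]
  and h_diff = Vector_Spaces.linear.axioms(3)[OF haar_linear, THEN module_hom.diff]

lemma act_Ki_eigen: "act UK x = z *s x \<Longrightarrow> z \<noteq> 0 \<Longrightarrow> act UKi x = (1 / z) *s x"
  using act_Ki_K[of x] act.scale[of UKi z x] by (metis scale_scale divide_self scale_one times_divide_eq_left mult_1)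

lemma act_Ki_gen:
  "act UKi a = s *s a" "act UKi a' = (1 / s) *s a'" "act UKi c = (1 / s) *s c" "act UKi c' = s *s c'"
  using act_Ki_eigen[of a "1 / s"] act_Ki_eigen[of a' s] act_Ki_eigen[of c s] act_Ki_eigen[of c' "1 / s"]
  by (simp_all add: act_K_a act_K_a' act_K_c act_K_c')

lemmas act_K = act_K_mult act_K_a act_K_a' act_K_c act_K_c' act_K_1
lemmas act_E = act_E_mult act_E_a act_E_a' act_E_c act_E_c' act_E_1
lemmas act_F = act_F_mult act_F_a act_F_a' act_F_c act_F_c' act_F_1
lemmas act_linear_simps = act.add act.diff act.scale act.neg

primrec K_weight :: "su2_gen \<Rightarrow> complex" where
  "K_weight Ga = 1 / s" | "K_weight Ga' = s" | "K_weight Gc = s" | "K_weight Gc' = 1 / s"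

definition "K_weight_word u = prod_list (map K_weight u)"

lemma act_K_word: "act UK (ev (Word u)) = K_weight_word u *s ev (Word u)"
proof (induction u)
  case (Cons x u)
  then show ?case
    by (cases x) (simp_all add: ev_Cons K_weight_word_def act_K linear_simps mult.commute mult.left_commute)
qed (simp add: ev_Nil K_weight_word_def act_K_1)

text \<open>In the coproduct of a letter all first tensor factors have the weight of that letter.\<close>

lemma act_K_slice_word: "act UK (slice_word g u) = K_weight_word u *s slice_word g u"
proof (induction u arbitrary: g)
  case (Cons x u)
  show ?case
    by (cases x; simp only: slice_word_Cons Cons.IH act_linear_simps act_K linear_simps scale_scale;
        simp add: K_weight_word_def mult.commute mult.left_commute)
qed (simp add: slice_word_Nil K_weight_word_def act_K_1 act.scale)

text \<open>Both \<open>E\<close> and \<open>F\<close> send a generator to a multiple of its partner.\<close>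

primrec partner :: "su2_gen \<Rightarrow> su2_gen" where
  "partner Ga = Gc" | "partner Gc = Ga" | "partner Ga' = Gc'" | "partner Gc' = Ga'"

primrec Ki_weight :: "su2_gen \<Rightarrow> complex" where
  "Ki_weight Ga = s" | "Ki_weight Ga' = 1 / s" | "Ki_weight Gc = 1 / s" | "Ki_weight Gc' = s"

primrec E_coeff :: "su2_gen \<Rightarrow> complex" where
  "E_coeff Ga = 0" | "E_coeff Gc = 1" | "E_coeff Ga' = - Q" | "E_coeff Gc' = 0"

primrec F_coeff :: "su2_gen \<Rightarrow> complex" where
  "F_coeff Ga = 1" | "F_coeff Gc = 0" | "F_coeff Ga' = 0" | "F_coeff Gc' = - 1 / Q"

text \<open>The coproduct intertwines the action with the action on its first tensor factor. As \<open>\<Delta>\<close> and the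
slice maps are given on words, this is expressed by lifting \<open>E\<close> and \<open>F\<close>: the result of acting on
a word is a combination of words, and the same combination describes the action on the slice. In the
induction the first letter is either replaced by its partner, or kept and multiplied by its
\<open>K\<^sup>-\<^sup>1\<close>-weight.\<close>

lemma act_EF_lift:
  assumes X: "(X, k) \<in> {(UE, E_coeff), (UF, F_coeff)}"
  shows "\<exists>L. act X (ev (Word u)) = lincomb scale L (\<lambda>v. ev (Word v)) \<and>
    (\<forall>g. act X (slice_word g u) = lincomb scale L (slice_word g))"
proof (induction u)
  case Nil
  have "act X 1 = 0" using X act_E_1 act_F_1 by auto
  then show ?case
    by (intro exI[of _ "[]"]) (simp add: ev_Nil slice_word_Nil act.scale)
next
  case (Cons x u)
  then obtain L where L: "act X (ev (Word u)) = lincomb scale L (\<lambda>v. ev (Word v))"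
    "\<And>g. act X (slice_word g u) = lincomb scale L (slice_word g)" by auto
  let ?L = "(k x * K_weight_word u, partner x # u) #
    map (\<lambda>(z, v). (Ki_weight x * z, x # v)) L"
  have X_mult: "act X (y * z) = act X y * act UK z + act UKi y * act X z" for y z
    using X act_E_mult act_F_mult by auto
  note lift_L = slice_word_Cons lincomb_diff lincomb_add lincomb_scale lincomb_mult L(2)[symmetric]
  have slice_L:
    "lincomb scale L (\<lambda>v. slice_word g (Ga # v)) =
      a * act X (slice_word (\<lambda>x. g (a * x)) u) - Q *s (c' * act X (slice_word (\<lambda>x. g (c * x)) u))"
    "lincomb scale L (\<lambda>v. slice_word g (Ga' # v)) =
      a' * act X (slice_word (\<lambda>x. g (a' * x)) u) - Q *s (c * act X (slice_word (\<lambda>x. g (c' * x)) u))"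
    "lincomb scale L (\<lambda>v. slice_word g (Gc # v)) =
      c * act X (slice_word (\<lambda>x. g (a * x)) u) + a' * act X (slice_word (\<lambda>x. g (c * x)) u)"
    "lincomb scale L (\<lambda>v. slice_word g (Gc' # v)) =
      c' * act X (slice_word (\<lambda>x. g (a' * x)) u) + a * act X (slice_word (\<lambda>x. g (c' * x)) u)"
    for g by (simp_all only: lift_L)
  have ev_L: "lincomb scale L (\<lambda>v. ev (Word (x # v))) = su2_value star a c x * act X (ev (Word u))"
    by (simp only: ev_Cons lincomb_mult L(1))
  have X_val: "(X = UE \<and> k = E_coeff) \<or> (X = UF \<and> k = F_coeff)" using X by auto
  have X_gen: "act X (su2_value star a c y) = k y *s su2_value star a c (partner y)" for y
    using X_val by (cases y) (auto simp: act_E act_F)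
  have X_a: "act X a = k Ga *s c" and X_a': "act X a' = k Ga' *s c'"
    and X_c: "act X c = k Gc *s a" and X_c': "act X c' = k Gc' *s a'"
    using X_gen[of Ga] X_gen[of Ga'] X_gen[of Gc] X_gen[of Gc'] by simp_all
  have "act UKi (su2_value star a c x) = Ki_weight x *s su2_value star a c x"
    by (cases x) (simp_all add: act_Ki_gen)
  then have ev: "act X (ev (Word (x # u))) = lincomb scale ?L (\<lambda>v. ev (Word v))"
    by (simp only: lincomb_Cons lincomb_map ev_L)
      (simp add: ev_Cons X_mult X_gen act_K_word linear_simps mult.commute)
  \<comment> \<open>These relations between the coefficients make the two summands of the coproduct of a letter match.\<close>
  have k: "k Ga = - Q * k Gc'" "k Ga' = - Q * k Gc" using X_val by auto
  have slice: "act X (slice_word g (x # u)) = lincomb scale ?L (slice_word g)" for g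
    unfolding lincomb_Cons lincomb_map
    by (cases x; simp only: slice_L; simp add: slice_word_Cons act.add act.diff act.scale X_mult
        X_a X_a' X_c X_c' k act_K_slice_word act_Ki_gen linear_simps mult.commute mult.left_commute)
  show ?case by (intro exI conjI allI) (rule ev, rule slice)
qed

lemma haar_invariance_word: "slice_word h u = h (ev (Word u)) *s 1"
  using haar_invariant_right[of "Poly_Mapping.single (Word u) 1"]
  by (simp add: slice_word_def su2_coproduct_word free_ev_single)

lemma one_neq_zero: "(1::'a) \<noteq> 0"
  using haar_one h_zero by force

text \<open>Applying \<open>E\<close> to \<open>(id \<otimes> h) \<Delta>(x) = h(x) 1\<close> turns the left-hand side into
\<open>(id \<otimes> h) \<Delta>(x \<triangleleft> E) = h(x \<triangleleft> E) 1\<close> and the right-hand side into \<open>h(x) (1 \<triangleleft> E) = 0\<close>; likewise for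
\<open>F\<close>.\<close>

lemma haar_EF:
  assumes "X \<in> {UE, UF}"
  shows "h (act X x) = 0"
proof -
  obtain k where X: "(X, k) \<in> {(UE, E_coeff), (UF, F_coeff)}" using assms by auto
  have word: "h (act X (ev w)) = 0" for w
  proof (cases w)
    case (Word u)
    obtain L where L: "act X (ev (Word u)) = lincomb scale L (\<lambda>v. ev (Word v))"
      "\<And>g. act X (slice_word g u) = lincomb scale L (slice_word g)"
      using act_EF_lift[OF X, of u] by auto
    have "h (lincomb scale L (\<lambda>v. ev (Word v))) *s 1 = lincomb scale L (\<lambda>v. h (ev (Word v)) *s 1)"
      by (induction L) (auto simp: h_zero h_add h_scale scale_left_distrib)
    also have "\<dots> = act X (h (ev (Word u)) *s 1)"
      unfolding haar_invariance_word[symmetric] L(2)[symmetric] ..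
    also have "act X 1 = 0" using assms act_E_1 act_F_1 by auto
    then have "act X (h (ev (Word u)) *s 1) = 0" by (simp only: act.scale scale_zero_right)
    finally show ?thesis using one_neq_zero L(1) Word by simp
  qed
  show ?thesis
    by (rule span_induct[OF word_span[of x]])
      (auto simp: word subspace_def act.zero act.add act.scale h_zero h_add h_scale)
qed

text \<open>Polarisation: the numbers \<open>h(y\<^sup>* y)\<close> for \<open>y = 1 + z x\<close> with \<open>z = 1\<close> and \<open>z = \<i>\<close> are real.\<close>

lemma haar_star: "h (star x) = cnj (h x)"
proof -
  have star_1: "star 1 = 1" by (metis mult_1_right star_mult star_star mult_1_left)
  define r where "r z = h (star (1 + z *s x) * (1 + z *s x))" for z
  have r: "Im (r z) = 0" for z
    unfolding r_def using haar_positive(1) complex_is_Real_iff by blast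
  have "r z = 1 + z * h x + cnj z * h (star x) + cnj z * z * h (star x * x)" for z
    unfolding r_def
    by (simp add: star_add star_scale star_1 distrib_left distrib_right scale_mult_left
        scale_mult_right h_add h_scale haar_one)
  moreover have "Im (h (star x * x)) = 0" using haar_positive(1) complex_is_Real_iff by blast
  ultimately have "Im (h x) + Im (h (star x)) = 0" "Re (h x) - Re (h (star x)) = 0"
    using r[of 1] r[of \<i>] by simp_all
  then show ?thesis by (simp add: complex_eq_iff)
qed

end

section \<open>The Podles sphere\<close>

context quantum_SU2
begin

abbreviation "A \<equiv> podles_A star c"
abbreviation "B \<equiv> podles_B a c"
abbreviation "B' \<equiv> star B"
abbreviation "S \<equiv> podles_algebra scale star a c"

lemma Q_power_neq_1: "0 < n \<Longrightarrow> Q ^ n \<noteq> 1"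
  using q_pos q_less_1 power_strict_decreasing[of 0 n q]
  by (metis less_irrefl of_real_1 of_real_eq_iff of_real_power power_0)

lemma A_def: "A = c' * c" and B_def: "B = a * c" and B'_def: "B' = c' * a'"
  by (simp_all add: podles_A_def podles_B_def star_mult)

lemmas podles_defs = A_def B_def B'_def star_mult star_scale star_star

lemma podles_relations:
  "B * A = Q^2 *s (A * B)" "B' * A = (1 / Q^2) *s (A * B')"
  "B * B' = Q^2 *s A - Q^4 *s (A * A)" "B' * B = A - A * A"
  by (simp_all add: podles_defs normal_order power2_eq_square power4_eq_xxxx mult.assoc)

lemma podles_relations_assoc:
  "B * (A * z) = Q^2 *s (A * (B * z))" "B' * (A * z) = (1 / Q^2) *s (A * (B' * z))"
  "B * (B' * z) = Q^2 *s (A * z) - Q^4 *s (A * (A * z))" "B' * (B * z) = A * z - A * (A * z)"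
  using podles_relations[THEN arg_cong, of "\<lambda>x. x * z"]
  by (simp_all add: scale_mult_left left_diff_distrib mult.assoc)

lemma S_A [simp]: "A \<in> S" and S_B [simp]: "B \<in> S" and S_B' [simp]: "B' \<in> S"
  and S_1 [simp]: "1 \<in> S" and S_add [simp]: "x \<in> S \<Longrightarrow> y \<in> S \<Longrightarrow> x + y \<in> S"
  and S_mult [simp]: "x \<in> S \<Longrightarrow> y \<in> S \<Longrightarrow> x * y \<in> S" and S_scale [simp]: "x \<in> S \<Longrightarrow> z *s x \<in> S"
  unfolding podles_algebra_def by (auto intro: generated_subalgebra.intros)

lemma S_0 [simp]: "0 \<in> S"
  and S_diff [simp]: "x \<in> S \<Longrightarrow> y \<in> S \<Longrightarrow> x - y \<in> S" and S_power [simp]: "x \<in> S \<Longrightarrow> x ^ n \<in> S"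
proof -
  show "0 \<in> S" using S_scale[OF S_1, of 0] by simp
  have m: "- x \<in> S" if "x \<in> S" for x using S_scale[OF that, of "-1"] by simp
  show "x - y \<in> S" if "x \<in> S" "y \<in> S" using S_add[OF that(1) m[OF that(2)]] by simp
  show "x ^ n \<in> S" if "x \<in> S" by (induction n) (use that in auto)
qed

lemma S_induct [consumes 1, case_names A B B' one add mult scale]:
  assumes "x \<in> S" "P A" "P B" "P B'" "P 1"
    "\<And>x y. x \<in> S \<Longrightarrow> y \<in> S \<Longrightarrow> P x \<Longrightarrow> P y \<Longrightarrow> P (x + y)"
    "\<And>x y. x \<in> S \<Longrightarrow> y \<in> S \<Longrightarrow> P x \<Longrightarrow> P y \<Longrightarrow> P (x * y)"
    "\<And>z x. x \<in> S \<Longrightarrow> P x \<Longrightarrow> P (z *s x)"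
  shows "P x"
  using assms(1) unfolding podles_algebra_def
  by (induction rule: generated_subalgebra.induct) (use assms(2-) in \<open>auto simp: podles_algebra_def\<close>)

lemma B_A_power: "B * A ^ r = Q^(2*r) *s (A ^ r * B)"
  and B'_A_power: "B' * A ^ r = (1 / Q^(2*r)) *s (A ^ r * B')"
  by (induction r)
    (simp_all add: podles_relations_assoc linear_simps power2_eq_square mult.commute mult.left_commute)

lemma B_A_power_assoc: "B * (A ^ r * z) = Q^(2*r) *s (A ^ r * (B * z))"
  and B'_A_power_assoc: "B' * (A ^ r * z) = (1 / Q^(2*r)) *s (A ^ r * (B' * z))"
  using B_A_power[THEN arg_cong, of "\<lambda>x. x * z" r] B'_A_power[THEN arg_cong, of "\<lambda>x. x * z" r]
  by (simp_all add: scale_mult_left mult.assoc)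

lemma A_A_power: "A * (A ^ r * z) = A ^ r * (A * z)"
  by (metis mult.assoc power_commutes)

lemma power_mult_square: "x ^ n * (x * x) = x * (x * x ^ n)" for x :: 'a
  by (metis mult.assoc power_commutes)

lemma podles_left_mult:
  "B * (A ^ r * B ^ s) = Q^(2*r) *s (A ^ r * B ^ Suc s)"
  "B * (A ^ r * B' ^ Suc s) =
     Q^(2*r) *s (Q^2 *s (A ^ Suc r * B' ^ s) - Q^4 *s (A ^ Suc (Suc r) * B' ^ s))"
  "B' * (A ^ r * B' ^ s) = (1 / Q^(2*r)) *s (A ^ r * B' ^ Suc s)"
  "B' * (A ^ r * B ^ Suc s) = (1 / Q^(2*r)) *s (A ^ Suc r * B ^ s - A ^ Suc (Suc r) * B ^ s)"
  by (simp_all add: B_A_power_assoc B'_A_power_assoc podles_relations_assoc linear_simps A_A_power)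

text \<open>The monomials \<open>A\<^sup>r B\<^sup>s\<close> and \<open>A\<^sup>r B\<^sup>*\<^sup>s\<close> span \<open>S\<close>: their span \<open>T\<close> contains \<open>1\<close> and is stable under left
multiplication by the generators.\<close>

lemma S_basis_induct [consumes 1, case_names B B' add scale]:
  assumes x: "x \<in> S" and B: "\<And>r s. P (A ^ r * B ^ s)" and B': "\<And>r s. P (A ^ r * B' ^ s)"
    and add: "\<And>x y. x \<in> S \<Longrightarrow> y \<in> S \<Longrightarrow> P x \<Longrightarrow> P y \<Longrightarrow> P (x + y)"
    and scale: "\<And>z x. x \<in> S \<Longrightarrow> P x \<Longrightarrow> P (z *s x)"
  shows "P x"
proof -
  define M where "M = (\<Union>r s. {A ^ r * B ^ s, A ^ r * B' ^ s})"
  define T where "T = span M"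
  have M: "A ^ r * B ^ s \<in> T" "A ^ r * B' ^ s \<in> T" for r s
    unfolding T_def M_def by (auto intro: span_base)
  have T: "0 \<in> T" "u \<in> T \<Longrightarrow> v \<in> T \<Longrightarrow> u + v \<in> T" "u \<in> T \<Longrightarrow> v \<in> T \<Longrightarrow> u - v \<in> T" "u \<in> T \<Longrightarrow> z *s u \<in> T" for u v z
    unfolding T_def by (auto intro: span_zero span_add span_diff span_scale)
  have closed: "g * t \<in> T" if "\<And>m. m \<in> M \<Longrightarrow> g * m \<in> T" "t \<in> T" for g t
    using that(2) unfolding T_def
    by (rule span_induct) (use that(1) T in \<open>auto simp: subspace_def distrib_left scale_mult_right T_def\<close>)
  have A: "A * m \<in> T" if "m \<in> M" for m
  proof -
    have "A * (A ^ r * u) = A ^ Suc r * u" for r u by (simp add: mult.assoc)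
    then have "A * (A ^ r * B ^ s) \<in> T" "A * (A ^ r * B' ^ s) \<in> T" for r s by (simp_all only: M)
    then show ?thesis using that by (auto simp: M_def)
  qed
  have gen_B: "B * m \<in> T" if m: "m \<in> M" for m
  proof -
    have 1: "B * (A ^ r * B ^ s) \<in> T" "B * (A ^ r * B' ^ Suc s) \<in> T" for r s
      by (simp_all only: podles_left_mult T M)
    moreover have "B * (A ^ r * B' ^ 0) \<in> T" for r using 1(1)[of r 0] by simp
    ultimately have "B * (A ^ r * B ^ s) \<in> T" "B * (A ^ r * B' ^ s) \<in> T" for r s
      by (simp, cases s, simp_all only:)
    then show ?thesis using m by (auto simp: M_def)
  qed
  have gen_B': "B' * m \<in> T" if m: "m \<in> M" for m
  proof -
    have 1: "B' * (A ^ r * B' ^ s) \<in> T" "B' * (A ^ r * B ^ Suc s) \<in> T" for r s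
      by (simp_all only: podles_left_mult T M)
    moreover have "B' * (A ^ r * B ^ 0) \<in> T" for r using 1(1)[of r 0] by simp
    ultimately have "B' * (A ^ r * B ^ s) \<in> T" "B' * (A ^ r * B' ^ s) \<in> T" for r s
      by (cases s, simp_all only:)
    then show ?thesis using m by (auto simp: M_def)
  qed
  have "\<forall>t\<in>T. x * t \<in> T"
    using x
  proof (induction rule: S_induct)
    case (add x y)
    then show ?case by (simp add: distrib_right T)
  next
    case (mult x y)
    then show ?case by (simp add: mult.assoc)
  next
    case (scale z x)
    then show ?case by (simp add: scale_mult_left T)
  qed (use closed A gen_B gen_B' in auto)
  moreover have "1 \<in> T" using M[of 0 0] by simp
  ultimately have "x \<in> T" by fastforce
  have P_0: "P 0" using scale[OF S_1, of 0] B[of 0 0] by simp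
  from \<open>x \<in> T\<close> have "x \<in> S \<and> P x"
    unfolding T_def
  proof (rule span_induct)
    show "subspace {x. x \<in> S \<and> P x}"
      using add scale P_0 by (auto simp: subspace_def)
  qed (use B B' in \<open>auto simp: M_def\<close>)
  then show ?thesis by simp
qed

section \<open>Linear functionals and twisted traces on the Podles sphere\<close>

lemma B_power_A: "B ^ m * A ^ k = Q^(2 * k * m) *s (A ^ k * B ^ m)"
  and B'_power_A: "B' ^ m * A ^ k = (1 / Q^(2 * k * m)) *s (A ^ k * B' ^ m)"
  by (induction m)
    (simp_all add: B_A_power_assoc B'_A_power_assoc linear_simps power_add mult.commute)

text \<open>Both \<open>\<sigma>\<close>, with \<open>\<mu> = q\<^sup>2\<close>, and the identity, with \<open>\<mu> = 1\<close>, are twists. This lets \<open>twisted_trace\<close>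
serve for \<open>h\<^sub>A\<close> and for the ordinary trace \<open>Tr\<close> alike.\<close>

definition twist :: "complex \<Rightarrow> ('a \<Rightarrow> 'a) \<Rightarrow> bool" where
  "twist \<mu> \<rho> \<longleftrightarrow> \<mu> \<noteq> 0 \<and> (\<forall>x\<in>S. \<rho> x \<in> S) \<and> \<rho> 1 = 1 \<and>
     (\<forall>x\<in>S. \<forall>y\<in>S. \<rho> (x + y) = \<rho> x + \<rho> y \<and> \<rho> (x * y) = \<rho> x * \<rho> y) \<and>
     (\<forall>z. \<forall>x\<in>S. \<rho> (z *s x) = z *s \<rho> x) \<and>
     \<rho> A = A \<and> \<rho> B = \<mu> *s B \<and> \<rho> B' = (1 / \<mu>) *s B'"

lemma twist_id: "twist 1 (\<lambda>x. x)"
  by (simp add: twist_def)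

lemma functional_simps:
  assumes "linear_functional_on scale S T"
  shows "x \<in> S \<Longrightarrow> y \<in> S \<Longrightarrow> T (x + y) = T x + T y" "x \<in> S \<Longrightarrow> T (z *s x) = z * T x"
    "x \<in> S \<Longrightarrow> y \<in> S \<Longrightarrow> T (x - y) = T x - T y" "T 0 = 0"
proof -
  show add: "T (x + y) = T x + T y" if "x \<in> S" "y \<in> S" for x y
    using assms that by (simp add: linear_functional_on_def)
  show sc: "T (z *s x) = z * T x" if "x \<in> S" for x z
    using assms that by (simp add: linear_functional_on_def)
  show "T (x - y) = T x - T y" if "x \<in> S" "y \<in> S" for x y
    using add[OF S_diff[OF that] that(2)] by simp
  show "T 0 = 0" using sc[OF S_0, of 0] by simp
qed

lemma functional_eqI:
  assumes T: "linear_functional_on scale S T" and T': "linear_functional_on scale S T'"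
    and "\<And>r. T (A ^ r) = T' (A ^ r)"
    and "\<And>r m. T (A ^ r * B ^ Suc m) = T' (A ^ r * B ^ Suc m)"
    and "\<And>r m. T (A ^ r * B' ^ Suc m) = T' (A ^ r * B' ^ Suc m)"
    and "x \<in> S"
  shows "T x = T' x"
  using \<open>x \<in> S\<close>
proof (induction rule: S_basis_induct)
  case (B r m)
  then show ?case using assms(3)[of r] assms(4)[of r "m - 1"] by (cases m) auto
next
  case (B' r m)
  then show ?case using assms(3)[of r] assms(5)[of r "m - 1"] by (cases m) auto
qed (simp_all add: functional_simps[OF T] functional_simps[OF T'])

lemma functional_comp_mult:
  assumes "linear_functional_on scale S T" "y \<in> S"
  shows "linear_functional_on scale S (\<lambda>x. z * T (x * y))" "linear_functional_on scale S (\<lambda>x. z * T (y * x))"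
  using assms(2) by (simp_all add: linear_functional_on_def functional_simps[OF assms(1)] distrib_right
      distrib_left scale_mult_left scale_mult_right ring_distribs)

text \<open>The twisted trace property has to be checked on products of a basis monomial with a generator only.
If \<open>T\<close> vanishes on the monomials that contain \<open>B\<close> or \<open>B\<^sup>*\<close>, the only condition left comes from
\<open>T(A\<^sup>r B\<^sup>* B) = \<mu> T(B A\<^sup>r B\<^sup>*)\<close>, which relates consecutive values \<open>T(A\<^sup>r\<^sup>+\<^sup>1)\<close>. It does not involve
\<open>T(1)\<close>, since \<open>B\<^sup>* B\<close> and \<open>B B\<^sup>*\<close> are multiples of \<open>A\<close>.\<close>

lemma twisted_trace:
  assumes T: "linear_functional_on scale S T"
    and B: "\<And>r m. T (A ^ r * B ^ Suc m) = 0" and B': "\<And>r m. T (A ^ r * B' ^ Suc m) = 0"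
    and rec: "\<And>r. \<mu> * Q^(2*r) * (Q^2 * T (A ^ Suc r) - Q^4 * T (A ^ Suc (Suc r))) =
      T (A ^ Suc r) - T (A ^ Suc (Suc r))"
    and \<rho>: "twist \<mu> \<rho>" and "x \<in> S" "y \<in> S"
  shows "T (x * y) = T (\<rho> y * x)"
proof -
  note T_simps = functional_simps[OF T]
  have \<mu>: "\<mu> \<noteq> 0" using \<rho> by (simp add: twist_def)
  have B_A: "T (A ^ r * B ^ Suc m * A ^ k) = 0" and B'_A: "T (A ^ r * B' ^ Suc m * A ^ k) = 0" for r m k
    unfolding mult.assoc B_power_A B'_power_A scale_mult_right
    by (simp_all only: T_simps S_mult S_power S_A S_B S_B' B B' flip: mult.assoc power_add) simp_all
  have gen_A: "T (x * A) = 1 * T (A * x)" if "x \<in> S" for x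
  proof (rule functional_eqI[OF _ _ _ _ _ that, where T = "\<lambda>x. T (x * A)"])
    show "linear_functional_on scale S (\<lambda>x. T (x * A))" "linear_functional_on scale S (\<lambda>x. 1 * T (A * x))"
      using functional_comp_mult[OF T S_A, of 1] by simp_all
  next
    show "T (A ^ r * A) = 1 * T (A * A ^ r)" for r by (simp add: power_commutes)
  next
    show "T (A ^ r * B ^ Suc m * A) = 1 * T (A * (A ^ r * B ^ Suc m))" for r m
      using B_A[of r m 1] B[of "Suc r" m] by (simp add: mult.assoc)
    show "T (A ^ r * B' ^ Suc m * A) = 1 * T (A * (A ^ r * B' ^ Suc m))" for r m
      using B'_A[of r m 1] B'[of "Suc r" m] by (simp add: mult.assoc)
  qed
  have gen_B: "T (x * B) = \<mu> * T (B * x)" if "x \<in> S" for x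
  proof (rule functional_eqI[OF _ _ _ _ _ that, where T = "\<lambda>x. T (x * B)"])
    show "linear_functional_on scale S (\<lambda>x. T (x * B))" "linear_functional_on scale S (\<lambda>x. \<mu> * T (B * x))"
      using functional_comp_mult[OF T S_B, of 1] functional_comp_mult[OF T S_B, of \<mu>] by simp_all
  next
    show "T (A ^ r * B) = \<mu> * T (B * A ^ r)" for r
      using B[of r 0] by (simp add: B_A_power T_simps)
    show "T (A ^ r * B ^ Suc m * B) = \<mu> * T (B * (A ^ r * B ^ Suc m))" for r m
      using B[of r "Suc m"] unfolding podles_left_mult
      by (simp add: T_simps mult.assoc power_commutes)
    show "T (A ^ r * B' ^ Suc m * B) = \<mu> * T (B * (A ^ r * B' ^ Suc m))" for r m
    proof -
      have "A ^ r * B' ^ Suc m * B = A ^ r * B' ^ m * A ^ 1 - A ^ r * B' ^ m * A ^ 2"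
        by (simp only: power_Suc2 mult.assoc podles_relations) (simp add: right_diff_distrib power2_eq_square mult.assoc)
      then have lhs: "T (A ^ r * B' ^ Suc m * B) = T (A ^ r * B' ^ m * A ^ 1) - T (A ^ r * B' ^ m * A ^ 2)"
        by (simp only: T_simps S_mult S_power S_A S_B S_B')
      have rhs: "T (B * (A ^ r * B' ^ Suc m)) =
          Q^(2*r) * (Q^2 * T (A ^ Suc r * B' ^ m) - Q^4 * T (A ^ Suc (Suc r) * B' ^ m))"
        unfolding podles_left_mult
        by (simp only: T_simps S_diff S_scale S_mult S_power S_A S_B S_B')
      show ?thesis
      proof (cases m)
        case 0
        have "T (A ^ r * B' ^ m * A ^ 1) - T (A ^ r * B' ^ m * A ^ 2) = T (A ^ Suc r) - T (A ^ Suc (Suc r))"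
          unfolding 0 by (simp add: power_commutes power2_eq_square power_mult_square)
        with rec[of r] show ?thesis unfolding lhs rhs by (simp add: 0 mult.assoc del: power_Suc)
      next
        case (Suc n)
        show ?thesis unfolding lhs rhs unfolding Suc B'_A B' by simp
      qed
    qed
  qed
  have gen_B': "T (x * B') = (1 / \<mu>) * T (B' * x)" if "x \<in> S" for x
  proof (rule functional_eqI[OF _ _ _ _ _ that, where T = "\<lambda>x. T (x * B')"])
    show "linear_functional_on scale S (\<lambda>x. T (x * B'))" "linear_functional_on scale S (\<lambda>x. (1 / \<mu>) * T (B' * x))"
      using functional_comp_mult(1)[OF T S_B', of 1] functional_comp_mult(2)[OF T S_B', of "1 / \<mu>"] by simp_all
  next
    show "T (A ^ r * B') = (1 / \<mu>) * T (B' * A ^ r)" for r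
      using B'[of r 0] by (simp add: B'_A_power T_simps)
    show "T (A ^ r * B' ^ Suc m * B') = (1 / \<mu>) * T (B' * (A ^ r * B' ^ Suc m))" for r m
      using B'[of r "Suc m"] unfolding podles_left_mult
      by (simp add: T_simps mult.assoc power_commutes)
    show "T (A ^ r * B ^ Suc m * B') = (1 / \<mu>) * T (B' * (A ^ r * B ^ Suc m))" for r m
    proof -
      have "A ^ r * B ^ Suc m * B' = Q^2 *s (A ^ r * B ^ m * A ^ 1) - Q^4 *s (A ^ r * B ^ m * A ^ 2)"
        by (simp only: power_Suc2 mult.assoc podles_relations)
          (simp add: right_diff_distrib scale_mult_right power2_eq_square mult.assoc)
      then have lhs: "T (A ^ r * B ^ Suc m * B') =
          Q^2 * T (A ^ r * B ^ m * A ^ 1) - Q^4 * T (A ^ r * B ^ m * A ^ 2)"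
        by (simp only: T_simps S_scale S_mult S_power S_A S_B S_B')
      have rhs: "T (B' * (A ^ r * B ^ Suc m)) =
          (1 / Q^(2*r)) * (T (A ^ Suc r * B ^ m) - T (A ^ Suc (Suc r) * B ^ m))"
        unfolding podles_left_mult
        by (simp only: T_simps S_diff S_scale S_mult S_power S_A S_B S_B')
      show ?thesis
      proof (cases m)
        case 0
        have "Q^2 * T (A ^ r * B ^ m * A ^ 1) - Q^4 * T (A ^ r * B ^ m * A ^ 2) =
            Q^2 * T (A ^ Suc r) - Q^4 * T (A ^ Suc (Suc r))"
          unfolding 0 by (simp add: power_commutes power2_eq_square power_mult_square)
        also have "\<dots> = (1 / \<mu>) * (1 / Q^(2*r)) * (T (A ^ Suc r) - T (A ^ Suc (Suc r)))"
          unfolding rec[symmetric] using \<mu> by simp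
        finally show ?thesis unfolding lhs rhs by (simp add: 0 del: power_Suc)
      next
        case (Suc n)
        show ?thesis unfolding lhs rhs unfolding Suc B_A B by simp
      qed
    qed
  qed
  \<comment> \<open>The elements \<open>y\<close> with this property form a subalgebra.\<close>
  have "\<forall>x\<in>S. T (x * y) = T (\<rho> y * x)"
    using \<open>y \<in> S\<close>
  proof (induction rule: S_induct)
    case (mult y z)
    show ?case
    proof
      fix x assume x: "x \<in> S"
      have "T (x * (y * z)) = T (\<rho> z * (x * y))"
        using mult x by (simp flip: mult.assoc)
      also have "\<dots> = T (\<rho> y * (\<rho> z * x))"
        using mult x \<rho> by (simp add: twist_def flip: mult.assoc)
      also have "\<dots> = T (\<rho> (y * z) * x)"
        using mult \<rho> by (simp add: twist_def mult.assoc)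
      finally show "T (x * (y * z)) = T (\<rho> (y * z) * x)" .
    qed
  next
    case (add y z)
    then show ?case using \<rho> by (auto simp: twist_def distrib_left distrib_right T_simps)
  next
    case (scale k y)
    then show ?case using \<rho> by (auto simp: twist_def scale_mult_left scale_mult_right T_simps)
  qed (use \<rho> gen_A gen_B gen_B' in \<open>auto simp: twist_def scale_mult_left T_simps\<close>)
  then show ?thesis using \<open>x \<in> S\<close> by blast
qed

text \<open>Commuting with \<open>A\<close> multiplies \<open>A\<^sup>r B\<^sup>s\<close> by \<open>q\<^sup>2\<^sup>s \<noteq> 1\<close>, which forces the value \<open>0\<close> if \<open>r > 0\<close>; for \<open>r = 0\<close>
the twist by \<open>B\<close> itself does. On the powers of \<open>A\<close> the trace property for \<open>B\<^sup>*\<close> and \<open>A\<^sup>r B\<close> is a two-term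
recursion that starts at \<open>A\<close>.\<close>

lemma twisted_trace_unique:
  assumes T: "linear_functional_on scale S T"
    and A: "\<And>x. x \<in> S \<Longrightarrow> T (x * A) = T (A * x)"
    and B: "\<And>x. x \<in> S \<Longrightarrow> T (x * B) = Q^2 * T (B * x)"
    and B': "\<And>x. x \<in> S \<Longrightarrow> T (x * B') = (1 / Q^2) * T (B' * x)"
    and T_1: "T 1 = 0" and T_A: "T A = 0" and "x \<in> S"
  shows "T x = 0"
proof (rule functional_eqI[OF T _ _ _ _ \<open>x \<in> S\<close>, where T' = "\<lambda>x. 0"])
  show "linear_functional_on scale S (\<lambda>x. 0)" by (simp add: linear_functional_on_def)
  note T_simps = functional_simps[OF T]
  have Q2: "Q^2 \<noteq> 1" using Q_power_neq_1[of 2] by simp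
  have Qm: "Q^(2 * Suc m) \<noteq> 1" for m using Q_power_neq_1[of "2 * Suc m"] by simp
  show "T (A ^ r * B ^ Suc m) = 0" for r m
  proof (cases r)
    case 0
    have "T (B ^ Suc m) = Q^2 * T (B ^ Suc m)"
      using B[of "B ^ m"] by (simp add: power_commutes)
    then show ?thesis using Q2 0 by simp
  next
    case (Suc k)
    have "A ^ k * B ^ Suc m * A = Q^(2 * Suc m) *s (A ^ Suc k * B ^ Suc m)"
      using B_power_A[of "Suc m" 1] by (simp add: mult.assoc scale_mult_right A_A_power)
    then have "T (A ^ k * B ^ Suc m * A) = Q^(2 * Suc m) * T (A ^ Suc k * B ^ Suc m)"
      by (simp only: T_simps S_mult S_power S_A S_B)
    moreover have "T (A ^ k * B ^ Suc m * A) = T (A ^ Suc k * B ^ Suc m)"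
      using A[of "A ^ k * B ^ Suc m"] by (simp add: mult.assoc)
    ultimately show ?thesis unfolding Suc using Qm[of m] by (metis mult_cancel_right1)
  qed
  show "T (A ^ r * B' ^ Suc m) = 0" for r m
  proof (cases r)
    case 0
    have "T (B' ^ Suc m) = (1 / Q^2) * T (B' ^ Suc m)"
      using B'[of "B' ^ m"] by (simp add: power_commutes)
    then show ?thesis using Q2 0 by (auto simp: field_simps)
  next
    case (Suc k)
    have "A ^ k * B' ^ Suc m * A = (1 / Q^(2 * Suc m)) *s (A ^ Suc k * B' ^ Suc m)"
      using B'_power_A[of "Suc m" 1] by (simp add: mult.assoc scale_mult_right A_A_power)
    then have "T (A ^ k * B' ^ Suc m * A) = (1 / Q^(2 * Suc m)) * T (A ^ Suc k * B' ^ Suc m)"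
      by (simp only: T_simps S_mult S_power S_A S_B')
    moreover have "T (A ^ k * B' ^ Suc m * A) = T (A ^ Suc k * B' ^ Suc m)"
      using A[of "A ^ k * B' ^ Suc m"] by (simp add: mult.assoc)
    moreover have "1 / Q^(2 * Suc m) \<noteq> 1" using Qm[of m] by (simp only: divide_eq_1_iff) auto
    ultimately show ?thesis unfolding Suc by (metis mult_cancel_right1)
  qed
  have "T (A ^ Suc r) = 0" for r
  proof (induction r)
    case (Suc r)
    have "T (A ^ r * B * B') = Q^2 * T (A ^ Suc r) - Q^4 * T (A ^ Suc (Suc r))"
    proof -
      have "A ^ r * B * B' = Q^2 *s A ^ Suc r - Q^4 *s A ^ Suc (Suc r)"
        by (simp add: mult.assoc podles_relations linear_simps power_commutes power_mult_square)
      then show ?thesis by (simp only: T_simps S_scale S_power S_A)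
    qed
    moreover have "T (B' * (A ^ r * B)) = (1 / Q^(2*r)) * (T (A ^ Suc r) - T (A ^ Suc (Suc r)))"
    proof -
      have "B' * (A ^ r * B) = (1 / Q^(2*r)) *s (A ^ Suc r - A ^ Suc (Suc r))"
        using podles_left_mult(4)[of r 0] by simp
      then show ?thesis by (simp only: T_simps S_diff S_power S_A)
    qed
    ultimately have "Q^4 * T (A ^ Suc (Suc r)) = (1 / Q^2) * (1 / Q^(2*r)) * T (A ^ Suc (Suc r))"
      using B'[of "A ^ r * B"] Suc by simp
    then have "Q^(2*r + 6) * T (A ^ Suc (Suc r)) = T (A ^ Suc (Suc r))"
      by (simp add: field_simps power_add power2_eq_square power4_eq_xxxx eval_nat_numeral)
    then show ?case using Q_power_neq_1[of "2*r + 6"] by simp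
  qed (simp add: T_A)
  then show "T (A ^ r) = 0" for r using T_1 by (cases r) auto
qed

end

section \<open>The action on the Podles sphere and the values of the Haar state\<close>

context podles_haar
begin

abbreviation "E \<equiv> act UE"
abbreviation "F \<equiv> act UF"
abbreviation "e \<equiv> c' * a"
abbreviation "f \<equiv> a' * c"

lemma s_s [simp]: "s * s = Q" "s * (s * z) = Q * z"
  using s_sq by (simp_all add: mult.assoc[symmetric])

lemma act_K_S: "x \<in> S \<Longrightarrow> act UK x = x"
proof (induction rule: S_induct)
qed (simp_all add: podles_defs act_K act_linear_simps linear_simps)

lemma act_Ki_S: "x \<in> S \<Longrightarrow> act UKi x = x"
  using act_Ki_K[of x] act_K_S by simp

text \<open>As \<open>K\<close> acts trivially on \<open>S\<close>, the twist in the product rule disappears for a left factor in \<open>S\<close>.\<close>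

lemma E_mult: "x \<in> S \<Longrightarrow> E (x * y) = E x * act UK y + x * E y"
  and F_mult: "x \<in> S \<Longrightarrow> F (x * y) = F x * act UK y + x * F y"
  by (simp_all add: act_E_mult act_F_mult act_Ki_S)

lemma E_derivation: "x \<in> S \<Longrightarrow> y \<in> S \<Longrightarrow> E (x * y) = E x * y + x * E y"
  and F_derivation: "x \<in> S \<Longrightarrow> y \<in> S \<Longrightarrow> F (x * y) = F x * y + x * F y"
  by (simp_all add: E_mult F_mult act_K_S)

lemma E_A: "E A = s *s e" and E_B: "E B = s *s (a * a)" and E_B': "E B' = (- (Q * s)) *s (c' * c')"
  and F_A: "F A = (- (s / Q)) *s f" and F_B: "F B = s *s (c * c)" and F_B': "F B' = (- (s / Q)) *s (a' * a')"
  by (simp_all add: podles_defs act_E act_F act_K act_Ki_gen linear_simps mult.commute)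

definition geom :: "nat \<Rightarrow> real" where "geom n = (\<Sum>i<n. q ^ (2 * i))"

lemma geom_Suc: "geom 0 = 0" "geom (Suc n) = geom n + q ^ (2 * n)"
  by (simp_all add: geom_def)

lemma geom_nonneg: "0 \<le> geom n"
  using q_pos by (simp add: geom_def sum_nonneg)

lemma geom_eq: "(1 - q^2) * geom n = 1 - q ^ (2 * n)"
proof (induction n)
  case (Suc n)
  have "(1 - q^2) * geom (Suc n) = (1 - q ^ (2 * n)) + (1 - q^2) * q ^ (2 * n)"
    unfolding Suc[symmetric] by (simp add: geom_Suc distrib_left)
  then show ?case by (simp add: algebra_simps power2_eq_square)
qed (simp add: geom_Suc)

lemma E_A_power: "E (A ^ Suc r) = (s * of_real (geom (Suc r))) *s (A ^ r * e)"
proof (induction r)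
  case 0
  show ?case by (simp add: E_A geom_def)
next
  case (Suc r)
  have "e * A ^ n = Q^(2*n) *s (A ^ n * e)" for n
  proof (induction n)
    case (Suc n)
    have "e * A ^ Suc n = Q^2 *s (A * (e * A ^ n))"
      by (simp add: A_def normal_order power2_eq_square)
    also have "\<dots> = Q^(2 * Suc n) *s (A ^ Suc n * e)"
      unfolding Suc by (simp add: linear_simps power2_eq_square)
    finally show ?case .
  qed simp
  then have "E (A * A ^ Suc r) = s *s (Q^(2 * Suc r) *s (A ^ Suc r * e)) + A * E (A ^ Suc r)"
    by (simp only: E_derivation S_A S_power E_A scale_mult_left)
  also have "\<dots> = (s * of_real (geom (Suc (Suc r)))) *s (A ^ Suc r * e)"
    unfolding Suc geom_Suc(2)[of "Suc r"]
    by (simp add: linear_simps distrib_left scale_left_distrib del: geom_Suc)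
  finally show ?case by simp
qed

lemma E_A_power_f: "E (A ^ r) * f = (s * of_real (geom r)) *s (A ^ r - Q^2 *s A ^ Suc r)"
proof (cases r)
  case (Suc m)
  have "e * f = A - Q^2 *s (A * A)"
    by (simp add: A_def normal_order)
  then have "A ^ m * (e * f) = A ^ Suc m - Q^2 *s A ^ Suc (Suc m)"
    by (simp add: linear_simps power_commutes power_mult_square)
  then show ?thesis unfolding Suc E_A_power by (simp only: scale_mult_left mult.assoc)
qed (simp add: act_E_1 geom_def)

text \<open>The relation \<open>h((A\<^sup>r f) \<triangleleft> E) = 0\<close>, written out: \<open>A\<^sup>r f\<close> has the right weight for its image under
\<open>E\<close> to lie in \<open>S\<close>, and this image is a combination of \<open>A\<^sup>r\<close> and \<open>A\<^sup>r\<^sup>+\<^sup>1\<close>.\<close>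

lemma haar_A_Suc: "(1 - Q^(2*r + 4)) * h (A ^ Suc r) = (1 - Q^(2*r + 2)) * h (A ^ r)"
proof -
  let ?H = "h (A ^ r)" and ?H' = "h (A ^ Suc r)"
  have K: "act UK f = Q *s f"
    by (simp add: act_K linear_simps)
  have "E f = E a' * act UK c + act UKi a' * E c" by (rule act_E_mult)
  also have "\<dots> = (1 / s) *s (1 - (1 + Q^2) *s A)"
    by (simp add: A_def act_E act_K act_Ki_gen normal_order scale_left_distrib power2_eq_square field_simps)
  finally have "E (A ^ r * f) = (Q * (s * of_real (geom r))) *s (A ^ r - Q^2 *s A ^ Suc r) +
      (1 / s) *s (A ^ r - (1 + Q^2) *s A ^ Suc r)"
    by (simp add: E_mult K E_A_power_f scale_mult_right right_diff_distrib power_commutes del: power_Suc)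
      (simp add: power_commutes)
  then have "0 = Q * (s * of_real (geom r)) * (?H - Q^2 * ?H') + (1 / s) * (?H - (1 + Q^2) * ?H')"
    using haar_EF[of UE "A ^ r * f"] by (simp only: h_add h_diff h_scale) simp
  \<comment> \<open>The factor \<open>s (1 - q\<^sup>2)\<close> removes the square root and sums the geometric series.\<close>
  then have "0 = s * (1 - Q^2) * (Q * (s * of_real (geom r)) * (?H - Q^2 * ?H') + (1 / s) * (?H - (1 + Q^2) * ?H'))"
    by simp
  also have "\<dots> = Q^2 * ((1 - Q^2) * of_real (geom r)) * (?H - Q^2 * ?H') + (1 - Q^2) * (?H - (1 + Q^2) * ?H')"
  proof -
    have "s * (1 - Q^2) * (Q * (s * g) * u + (1 / s) * v) = Q^2 * ((1 - Q^2) * g) * u + (1 - Q^2) * v" for g u v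
      by (simp add: field_simps power2_eq_square)
    then show ?thesis .
  qed
  also have "(1 - Q^2) * of_real (geom r) = 1 - Q^(2*r)"
    using geom_eq[of r, THEN arg_cong, of complex_of_real] by simp
  finally show ?thesis
    by (simp add: algebra_simps power_add power2_eq_square power4_eq_xxxx)
qed

lemma haar_A: "h (A ^ r) = (1 - Q^2) / (1 - Q^(2*r + 2))"
proof (induction r)
  case 0
  have "1 - Q^2 \<noteq> 0" using Q_power_neq_1[of 2] by simp
  then show ?case by (simp only: haar_one mult_0_right add_0 power_0 divide_self simp_thms)
next
  case (Suc r)
  have "1 - Q^(2*r + 4) \<noteq> 0" "1 - Q^(2*r + 2) \<noteq> 0"
    using Q_power_neq_1[of "2*r+4"] Q_power_neq_1[of "2*r+2"] by auto
  moreover have "(1 - Q^(2*r + 4)) * h (A ^ Suc r) = 1 - Q^2"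
    unfolding haar_A_Suc Suc using \<open>1 - Q^(2*r + 2) \<noteq> 0\<close> by simp
  moreover have "2 * Suc r + 2 = 2 * r + 4" by simp
  ultimately show ?case by (simp only: eq_divide_eq mult.commute simp_thms if_True if_False)
qed

text \<open>By \<open>h((A\<^sup>r B\<^sup>m c\<^sup>2) \<triangleleft> E) = 0\<close>: the terms of the derivation rule are nonnegative multiples of
\<open>A\<^sup>r B\<^sup>m\<^sup>+\<^sup>1\<close>, and the one where \<open>E\<close> acts on \<open>c\<^sup>2\<close> is positive, so they cannot cancel.\<close>

lemma haar_A_B: "h (A ^ r * B ^ Suc m) = 0"
proof -
  let ?cc = "c * c"
  have "E (B ^ n) * ?cc = (s * Q * of_real (geom n)) *s B ^ Suc n" for n
  proof (induction n)
    case (Suc n)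
    have "(a * a) * B ^ k = Q^(2*k) *s (B ^ k * (a * a))" for k
    proof (induction k)
      case (Suc k)
      have "(a * a) * B ^ Suc k = Q^2 *s (B * ((a * a) * B ^ k))"
        by (simp add: B_def normal_order power2_eq_square)
      then show ?case unfolding Suc by (simp add: linear_simps power2_eq_square)
    qed simp
    then have "E (B ^ Suc n) * ?cc = (s * Q^(2*n)) *s (B ^ n * ((a * a) * ?cc)) + B * (E (B ^ n) * ?cc)"
      by (simp add: E_derivation E_B linear_simps)
    also have "(a * a) * ?cc = Q *s (B * B)"
      by (simp add: B_def normal_order)
    finally show ?case
      unfolding Suc by (simp add: linear_simps geom_Suc distrib_left scale_left_distrib power_commutes add.commute power_mult_square)
  qed (simp add: act_E_1 geom_def)
  note EB = this
  have "e * (B ^ n * ?cc) = Q^(2*n + 1) *s (A * B ^ Suc n)" for n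
  proof (induction n)
    case (Suc n)
    have "e * (B ^ Suc n * ?cc) = B * (e * (B ^ n * ?cc))"
      by (simp add: B_def normal_order)
    also have "\<dots> = Q^(2 * Suc n + 1) *s (A * B ^ Suc (Suc n))"
      unfolding Suc by (simp add: podles_relations_assoc linear_simps power2_eq_square)
    finally show ?case .
  qed (simp add: podles_defs normal_order)
  then have EA: "E (A ^ r) * (B ^ m * ?cc) = (s * of_real (geom r) * Q^(2*m+1)) *s (A ^ r * B ^ Suc m)"
    by (cases r) (simp_all add: E_A_power act_E_1 geom_def linear_simps A_A_power del: power_Suc of_real_sum,
        simp_all add: A_A_power mult.assoc)
  have K: "act UK ?cc = Q *s ?cc" by (simp add: act_K linear_simps)
  have cc: "E ?cc = (s + 1 / (s * Q)) *s B"
  proof -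
    have "(s + 1 / (s * Q)) * Q = Q * s + 1 / s" by (simp add: field_simps)
    then show ?thesis
      by (simp add: B_def act_E act_K act_Ki_gen normal_order add.commute mult.commute flip: scale_left_distrib)
  qed
  have "E (A ^ r * B ^ m * ?cc) = E (A ^ r) * (B ^ m * act UK ?cc) + A ^ r * (E (B ^ m) * act UK ?cc + B ^ m * E ?cc)"
    by (simp add: E_mult act_K_mult act_K_S distrib_left mult.assoc)
  also have "\<dots> = (Q * (s * of_real (geom r) * Q^(2*m+1)) + Q * (s * Q * of_real (geom m)) + (s + 1 / (s * Q))) *s
      (A ^ r * B ^ Suc m)"
    unfolding K cc scale_mult_right EA EB by (simp add: scale_left_distrib linear_simps power_commutes)
  finally have "0 = (Q * (s * of_real (geom r) * Q^(2*m+1)) + Q * (s * Q * of_real (geom m)) + (s + 1 / (s * Q))) *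
      h (A ^ r * B ^ Suc m)"
    using haar_EF[of UE "A ^ r * B ^ m * ?cc"] by (simp only: h_scale) simp
  also have "Q * (s * of_real (geom r) * Q^(2*m+1)) + Q * (s * Q * of_real (geom m)) + (s + 1 / (s * Q)) =
    of_real (q * (sqrt q * geom r * q^(2*m+1)) + q * (sqrt q * q * geom m) + (sqrt q + 1 / (sqrt q * q)))"
    by simp
  finally show ?thesis
    using q_pos geom_nonneg[of r] geom_nonneg[of m]
    by (smt (verit) mult_eq_0_iff of_real_eq_0_iff mult_nonneg_nonneg real_sqrt_gt_0_iff zero_le_power divide_pos_pos mult_pos_pos)
qed

lemma star_A [simp]: "star A = A"
  by (simp add: A_def star_mult star_star)

lemma star_power: "star (x ^ n) = star x ^ n"
proof (induction n)
  case 0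
  show ?case by (metis power_0 mult_1_right star_mult star_star mult_1_left)
qed (simp add: star_mult power_commutes)

lemma haar_A_B': "h (A ^ r * B' ^ Suc m) = 0"
proof -
  have "A ^ r * B' ^ Suc m = star (B ^ Suc m * A ^ r)"
    by (simp only: star_mult star_power star_A)
  then show ?thesis
    by (simp only: haar_star B_power_A h_scale haar_A_B) simp
qed

end

section \<open>A trace on the Podles sphere\<close>

text \<open>The columns of the infinite Cauchy matrix with entries \<open>1 / (1 - X\<^sup>i\<^sup>+\<^sup>k\<^sup>+\<^sup>1)\<close> are linearly
independent. After clearing denominators, a linear relation says that a polynomial vanishes at all
powers \<open>X\<^sup>k\<close>; so it is the zero polynomial, and evaluating it at \<open>X\<^sup>-\<^sup>i\<^sup>-\<^sup>1\<close> isolates the coefficient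
\<open>y i\<close>.\<close>

lemma cauchy_kernel_independent:
  fixes X :: complex and y :: "nat \<Rightarrow> complex"
  assumes X: "X \<noteq> 0" "\<And>n. 0 < n \<Longrightarrow> X ^ n \<noteq> 1"
    and I: "finite I" and zero: "\<And>k. (\<Sum>i\<in>I. y i / (1 - X ^ (i + k + 1))) = 0" and "i \<in> I"
  shows "y i = 0"
proof -
  have inj: "X ^ m = X ^ n \<longleftrightarrow> m = n" for m n
  proof (induction m n rule: linorder_wlog)
    case (le m n)
    then have "X ^ n = X ^ m * X ^ (n - m)" by (simp flip: power_add)
    then show ?case using X le by (cases "m = n") auto
  qed auto
  define P where "P = (\<Sum>i\<in>I. smult (y i) (\<Prod>j\<in>I - {i}. [:1, - (X ^ (j + 1)):]))"
  have P: "poly P z = (\<Sum>i\<in>I. y i * (\<Prod>j\<in>I - {i}. 1 - z * X ^ (j + 1)))" for z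
    by (simp add: P_def poly_sum poly_prod)
  have "poly P (X ^ k) = 0" for k
  proof -
    have "y i * (\<Prod>j\<in>I - {i}. 1 - X ^ k * X ^ (j + 1)) =
        (\<Prod>j\<in>I. 1 - X ^ k * X ^ (j + 1)) * (y i / (1 - X ^ (i + k + 1)))" if "i \<in> I" for i
    proof -
      define w where "w = X ^ (i + k + 1)"
      have "1 - w \<noteq> 0" unfolding w_def using X(2)[of "i + k + 1"] by simp
      moreover have "X ^ k * X ^ (i + 1) = w"
        unfolding w_def power_add[symmetric] by (rule arg_cong) simp
      ultimately show ?thesis
        unfolding prod.remove[OF I that] w_def[symmetric] by simp
    qed
    then have "poly P (X ^ k) =
        (\<Prod>j\<in>I. 1 - X ^ k * X ^ (j + 1)) * (\<Sum>i\<in>I. y i / (1 - X ^ (i + k + 1)))"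
      unfolding P sum_distrib_left by (intro sum.cong) auto
    then show ?thesis using zero by simp
  qed
  then have "range (\<lambda>k. X ^ k) \<subseteq> {z. poly P z = 0}" by auto
  moreover have "infinite (range (\<lambda>k. X ^ k))"
    using inj by (intro range_inj_infinite) (auto simp: inj_on_def)
  ultimately have "P = 0" using poly_roots_finite infinite_super by blast
  then have "0 = (\<Sum>k\<in>I. y k * (\<Prod>j\<in>I - {k}. 1 - (1 / X ^ (i + 1)) * X ^ (j + 1)))"
    using P[of "1 / X ^ (i + 1)"] by simp
  also have "\<dots> = y i * (\<Prod>j\<in>I - {i}. 1 - (1 / X ^ (i + 1)) * X ^ (j + 1))"
  proof (rule sum.remove[OF I \<open>i \<in> I\<close>, THEN trans])
    have "(\<Prod>j\<in>I - {k}. 1 - (1 / X ^ (i + 1)) * X ^ (j + 1)) = 0" if "k \<in> I - {i}" for k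
      using that \<open>i \<in> I\<close> X(1) I by (intro prod_zero) auto
    then show "y i * (\<Prod>j\<in>I - {i}. 1 - (1 / X ^ (i + 1)) * X ^ (j + 1)) +
        (\<Sum>k\<in>I - {i}. y k * (\<Prod>j\<in>I - {k}. 1 - (1 / X ^ (i + 1)) * X ^ (j + 1))) =
        y i * (\<Prod>j\<in>I - {i}. 1 - (1 / X ^ (i + 1)) * X ^ (j + 1))"
      by simp
  qed
  finally show ?thesis
    using I X(1) inj by (auto simp: field_simps simp flip: power_Suc)
qed

context podles_haar
begin

text \<open>Send \<open>x\<close> to the sequence of its moments \<open>h(A\<^sup>k x)\<close>. This map kills the monomials that contain \<open>B\<close> or
\<open>B\<^sup>*\<close>, and it sends the powers of \<open>A\<close> to multiples of the columns of a Cauchy matrix. These are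
independent, so a linear functional on the space of sequences may be prescribed on them.\<close>

lemma functional_exists:
  fixes t :: "nat \<Rightarrow> complex"
  obtains T where "\<And>x y. T (x + y) = T x + T y" "\<And>z x. T (z *s x) = z * T x" "\<And>r. T (A ^ r) = t r"
    "\<And>r m. T (A ^ r * B ^ Suc m) = 0" "\<And>r m. T (A ^ r * B' ^ Suc m) = 0"
proof -
  let ?scale = "\<lambda>(z::complex) (f::nat \<Rightarrow> complex) k. z * f k"
  define v where "v i k = h (A ^ k * A ^ i)" for i k
  have v: "v i k = (1 - Q^2) * (1 / (1 - (Q^2) ^ (i + k + 1)))" for i k
  proof -
    have "2 * (k + i) + 2 = 2 * (i + k + 1)" by simp
    then show ?thesis
      unfolding v_def power_add[symmetric] haar_A power_mult[symmetric] by (simp only:) simp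
  qed
  have Q2: "Q^2 \<noteq> 0" "0 < n \<Longrightarrow> (Q^2) ^ n \<noteq> 1" for n
    using Q_power_neq_1[of "2 * n"] by (simp_all add: power_mult)
  have Q1: "1 - Q^2 \<noteq> 0" using Q_power_neq_1[of 2] by simp
  have indep: "y i = 0" if "finite I" "(\<Sum>i\<in>I. ?scale (y i) (v i)) = 0" "i \<in> I" for I y i
  proof (rule cauchy_kernel_independent[OF Q2 that(1) _ that(3)])
    fix k
    have "0 = (\<Sum>i\<in>I. ?scale (y i) (v i)) k" using that(2) by simp
    also have "\<dots> = (\<Sum>i\<in>I. y i * v i k)" by (induction I rule: infinite_finite_induct) auto
    also have "\<dots> = (1 - Q^2) * (\<Sum>i\<in>I. y i / (1 - (Q^2) ^ (i + k + 1)))"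
      unfolding sum_distrib_left v by (intro sum.cong) auto
    finally show "(\<Sum>i\<in>I. y i / (1 - (Q^2) ^ (i + k + 1))) = 0" using Q1 by simp
  qed
  have seq: "vector_space ?scale"
    by standard (auto simp: algebra_simps)
  have seq_module: "module ?scale"
    by standard (auto simp: algebra_simps)
  have pair: "vector_space_pair ?scale ((*) :: complex \<Rightarrow> _)"
    by (intro vector_space_pair.intro seq) (standard, auto simp: algebra_simps)
  have inj: "inj v"
  proof (rule injI, rule ccontr)
    fix i j assume "v i = v j" "i \<noteq> j"
    then show False using indep[of "{i, j}" "\<lambda>k. if k = i then 1 else -1" i] by (auto simp: fun_eq_iff)
  qed
  have "\<not> module.dependent ?scale (range v)"
  proof
    assume "module.dependent ?scale (range v)"
    then obtain V u where V: "finite V" "V \<subseteq> range v" "\<exists>f\<in>V. u f \<noteq> 0" "(\<Sum>f\<in>V. ?scale (u f) f) = 0"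
      unfolding module.dependent_explicit[OF seq_module] by blast
    then obtain I where I: "V = v ` I" "finite I" by (meson finite_subset_image)
    have "(\<Sum>i\<in>I. ?scale (u (v i)) (v i)) = 0"
      using V(4) unfolding I(1) by (subst (asm) sum.reindex) (use inj in \<open>auto intro: inj_on_subset\<close>)
    then show False using indep[of I "\<lambda>i. u (v i)"] I V(3) by auto
  qed
  then obtain g where g: "Vector_Spaces.linear ?scale (*) g" "\<And>i. g (v i) = t i"
    using vector_space_pair.linear_independent_extend[OF pair, of "range v" "\<lambda>f. t (inv v f)"] inj by auto
  note g_add = Vector_Spaces.linear.axioms(3)[OF g(1), THEN module_hom.add]
    and g_scale = Vector_Spaces.linear.axioms(3)[OF g(1), THEN module_hom.scale]
    and g_zero = Vector_Spaces.linear.axioms(3)[OF g(1), THEN module_hom.zero]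
  define T where "T x = g (\<lambda>k. h (A ^ k * x))" for x
  have "T (x + y) = T x + T y" for x y
    using g_add[of "\<lambda>k. h (A ^ k * x)" "\<lambda>k. h (A ^ k * y)"]
    by (simp add: T_def distrib_left h_add plus_fun_def)
  moreover have "T (z *s x) = z * T x" for z x
    using g_scale[of z "\<lambda>k. h (A ^ k * x)"] by (simp add: T_def scale_mult_right h_scale)
  moreover have "T (A ^ r) = t r" for r
    using g(2)[of r] by (simp add: T_def v_def[abs_def])
  moreover have "T (A ^ r * B ^ Suc m) = 0" "T (A ^ r * B' ^ Suc m) = 0" for r m
    unfolding T_def mult.assoc[symmetric] power_add[symmetric] haar_A_B haar_A_B'
    using g_zero by (simp_all add: zero_fun_def)
  ultimately show thesis using that by blast
qed

text \<open>The values on the powers of \<open>A\<close> are \<open>\<Sum>k. q\<^sup>2\<^sup>r\<^sup>k\<close>. This sum diverges for \<open>r = 0\<close>; setting \<open>Tr 1 = 0\<close>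
amounts to subtracting \<open>p(0)\<close> from every \<open>p(q\<^sup>2\<^sup>k)\<close> in \<open>Tr p(A) = (\<Sum>k. p(q\<^sup>2\<^sup>k))\<close>.\<close>

definition Tr :: "'a \<Rightarrow> complex" where
  "Tr = (SOME T. (\<forall>x y. T (x + y) = T x + T y) \<and> (\<forall>z x. T (z *s x) = z * T x) \<and>
     (\<forall>r. T (A ^ r) = (if r = 0 then 0 else 1 / (1 - Q^(2*r)))) \<and>
     (\<forall>r m. T (A ^ r * B ^ Suc m) = 0 \<and> T (A ^ r * B' ^ Suc m) = 0))"

lemma Tr_add: "Tr (x + y) = Tr x + Tr y" and Tr_scale: "Tr (z *s x) = z * Tr x"
  and Tr_A: "Tr (A ^ Suc r) = 1 / (1 - Q^(2 * Suc r))"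
  and Tr_B: "Tr (A ^ r * B ^ Suc m) = 0" and Tr_B': "Tr (A ^ r * B' ^ Suc m) = 0"
proof -
  let ?t = "\<lambda>r. if r = 0 then 0 else 1 / (1 - Q^(2*r))"
  obtain T where T: "\<And>x y. T (x + y) = T x + T y" "\<And>z x. T (z *s x) = z * T x" "\<And>r. T (A ^ r) = ?t r"
    "\<And>r m. T (A ^ r * B ^ Suc m) = 0" "\<And>r m. T (A ^ r * B' ^ Suc m) = 0"
    by (rule functional_exists[of ?t]) (rule that)
  have "(\<forall>x y. Tr (x + y) = Tr x + Tr y) \<and> (\<forall>z x. Tr (z *s x) = z * Tr x) \<and>
     (\<forall>r. Tr (A ^ r) = ?t r) \<and> (\<forall>r m. Tr (A ^ r * B ^ Suc m) = 0 \<and> Tr (A ^ r * B' ^ Suc m) = 0)"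
    unfolding Tr_def by (rule someI[of _ T]) (use T in blast)
  then have *: "\<And>x y. Tr (x + y) = Tr x + Tr y" "\<And>z x. Tr (z *s x) = z * Tr x" "\<And>r. Tr (A ^ r) = ?t r"
    "\<And>r m. Tr (A ^ r * B ^ Suc m) = 0" "\<And>r m. Tr (A ^ r * B' ^ Suc m) = 0" by blast+
  show "Tr (x + y) = Tr x + Tr y" "Tr (z *s x) = z * Tr x"
    "Tr (A ^ Suc r) = 1 / (1 - Q^(2 * Suc r))" "Tr (A ^ r * B ^ Suc m) = 0" "Tr (A ^ r * B' ^ Suc m) = 0"
    using * *(3)[of "Suc r"] by (simp_all del: power_Suc)
qed

lemma Tr_diff: "Tr (x - y) = Tr x - Tr y"
  using Tr_add[of "x - y" y] by simp

lemma Tr_functional: "linear_functional_on scale S Tr"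
  by (simp add: linear_functional_on_def Tr_add Tr_scale)

text \<open>The condition of \<open>twisted_trace\<close> for the values \<open>k / (1 - w q\<^sup>2)\<close> and \<open>k / (1 - w q\<^sup>4)\<close>, which occur for
\<open>Tr\<close> with \<open>w = q\<^sup>2\<^sup>r\<close> and for \<open>h\<^sub>A\<close> with \<open>w = q\<^sup>2\<^sup>r\<^sup>+\<^sup>2\<close>.\<close>

lemma twisted_trace_recursion:
  fixes w :: complex
  assumes "w * Q^2 \<noteq> 1" "w * Q^4 \<noteq> 1"
  shows "w * (Q^2 * (k / (1 - w * Q^2)) - Q^4 * (k / (1 - w * Q^4))) = k / (1 - w * Q^2) - k / (1 - w * Q^4)"
proof -
  have "w * Q^2 * (k / (1 - w * Q^2)) = k / (1 - w * Q^2) - k"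
    "w * Q^4 * (k / (1 - w * Q^4)) = k / (1 - w * Q^4) - k"
    using assms by (simp_all add: field_simps)
  then show ?thesis by (simp add: right_diff_distrib flip: mult.assoc)
qed

lemma Tr_commute:
  assumes "x \<in> S" "y \<in> S"
  shows "Tr (x * y) = Tr (y * x)"
proof (rule twisted_trace[OF Tr_functional Tr_B Tr_B' _ twist_id assms])
  fix r
  have "Q^(2*r) * Q^2 = Q^(2 * Suc r)" "Q^(2*r) * Q^4 = Q^(2 * Suc (Suc r))"
    by (simp_all add: eval_nat_numeral mult.commute mult.left_commute)
  with twisted_trace_recursion[of "Q^(2*r)" 1]
  show "1 * Q^(2*r) * (Q^2 * Tr (A ^ Suc r) - Q^4 * Tr (A ^ Suc (Suc r))) =
      Tr (A ^ Suc r) - Tr (A ^ Suc (Suc r))"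
    unfolding Tr_A using Q_power_neq_1[of "2 * Suc r"] Q_power_neq_1[of "2 * Suc (Suc r)"] by simp
qed

lemma Tr_mult_A: "x \<in> S \<Longrightarrow> Tr (x * A) = h x / (1 - Q^2)"
proof (rule functional_eqI[where T = "\<lambda>x. Tr (x * A)" and T' = "\<lambda>x. h x / (1 - Q^2)"])
  show "linear_functional_on scale S (\<lambda>x. Tr (x * A))"
    using functional_comp_mult(1)[OF Tr_functional S_A, of 1] by simp
  show "linear_functional_on scale S (\<lambda>x. h x / (1 - Q^2))"
    by (simp add: linear_functional_on_def h_add h_scale add_divide_distrib)
  show "Tr (A ^ r * A) = h (A ^ r) / (1 - Q^2)" for r
    using Tr_A[of r] Q_power_neq_1[of 2] by (simp add: haar_A power_commutes)
  show "Tr (A ^ r * B ^ Suc m * A) = h (A ^ r * B ^ Suc m) / (1 - Q^2)" for r m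
    using B_power_A[of "Suc m" 1] Tr_B[of "Suc r" m]
    by (simp add: mult.assoc haar_A_B[simplified] linear_simps Tr_scale A_A_power)
  show "Tr (A ^ r * B' ^ Suc m * A) = h (A ^ r * B' ^ Suc m) / (1 - Q^2)" for r m
    using B'_power_A[of "Suc m" 1] Tr_B'[of "Suc r" m]
    by (simp add: mult.assoc haar_A_B'[simplified] linear_simps Tr_scale A_A_power)
qed

end

section \<open>Products of opposite weight\<close>

context quantum_SU2
begin

lemma podles_gen_move:
  "A * a' = Q^2 *s (a' * A)" "A * c = c * A" "B * a' = Q *s c - Q^3 *s (c * A)" "B * c = Q *s (c * B)"
  "B' * a' = Q *s (a' * B')" "B' * c = (1 / Q) *s (c * B')"
  "A * a = (1 / Q^2) *s (a * A)" "A * c' = c' * A" "B * a = (1 / Q) *s (a * B)" "B * c' = a * A"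
  "B' * a = c' - c' * A" "B' * c' = (1 / Q) *s (c' * B')"
  by (simp_all add: podles_defs normal_order power2_eq_square power3_eq_cube mult.assoc)

text \<open>The reason is \<open>S w + S w' \<subseteq> w S + w' S\<close>, where \<open>w, w'\<close> are the two generators of a given
\<open>K\<close>-weight. It is phrased with a right \<open>S\<close>-module \<open>Pr\<close> as target because it is applied twice: with
\<open>Pr\<close> equal to \<open>S\<close>, and then with \<open>Pr\<close> the module of all \<open>x\<close> for which \<open>x w\<close> and \<open>x w'\<close> lie
in \<open>S\<close>.\<close>

lemma right_module_move:
  assumes add: "\<And>x y. Pr x \<Longrightarrow> Pr y \<Longrightarrow> Pr (x + y)" and scale: "\<And>k x. Pr x \<Longrightarrow> Pr (k *s x)"
    and mult: "\<And>x z. Pr x \<Longrightarrow> z \<in> S \<Longrightarrow> Pr (x * z)"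
    and w: "(w, w') \<in> {(a', c), (a, c')}" and m: "Pr (m * w)" "Pr (m * w')" and "z \<in> S"
  shows "Pr (m * z * w) \<and> Pr (m * z * w')"
  using \<open>z \<in> S\<close> m
proof (induction arbitrary: m rule: S_induct)
  have diff: "Pr (x - y)" if "Pr x" "Pr y" for x y
    using add[OF that(1) scale[OF that(2), of "-1"]] by simp
  have mult': "Pr (x * (y * z))" if "Pr (x * y)" "z \<in> S" for x y z
    using mult[OF that] by (simp add: mult.assoc)
  note move = mult.assoc podles_gen_move right_diff_distrib scale_mult_right
  {
    case A
    then show ?case using w scale mult' by (auto simp: move)
  next
    case B
    then show ?case using w scale diff mult' by (auto simp: move)
  next
    case B'
    then show ?case using w scale diff mult' by (auto simp: move)
  next
    case (add x y)
    then show ?case using assms(1) by (simp add: distrib_left distrib_right)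
  next
    case (mult x y)
    then show ?case by (simp flip: mult.assoc)
  next
    case (scale k x)
    then show ?case using assms(2) by (simp add: scale_mult_left scale_mult_right)
  }
qed simp

text \<open>For \<open>w, w' = a\<^sup>*, c\<close> this holds for the images under \<open>E\<close>, and for \<open>w, w' = a, c\<^sup>*\<close> for those under \<open>F\<close>.
The products of such images that occur in \<open>\<tau>\<close> and \<open>\<psi>\<close> are \<open>K\<close>-invariant; the predicate serves to show
that they lie in \<open>S\<close>, where the formulas for \<open>h\<close> and \<open>Tr\<close> apply.\<close>

definition absorbs :: "'a \<Rightarrow> 'a \<Rightarrow> 'a \<Rightarrow> bool" where
  "absorbs w w' m \<longleftrightarrow> (\<forall>u\<in>{w, w'}. \<forall>v\<in>{w, w'}. m * u * v \<in> S)"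

lemma absorbs_closed:
  "absorbs w w' x \<Longrightarrow> absorbs w w' y \<Longrightarrow> absorbs w w' (x + y)"
  "absorbs w w' x \<Longrightarrow> absorbs w w' (k *s x)"
  "z \<in> S \<Longrightarrow> absorbs w w' x \<Longrightarrow> absorbs w w' (z * x)"
  by (auto simp: absorbs_def distrib_right scale_mult_left mult.assoc)

lemma absorbs_mult:
  assumes w: "(w, w') \<in> {(a', c), (a, c')}" and "absorbs w w' m" "z \<in> S"
  shows "absorbs w w' (m * z)"
proof -
  let ?P = "\<lambda>x. x * w \<in> S \<and> x * w' \<in> S"
  have P: "?P (x * z)" if "?P x" "z \<in> S" for x z
    by (rule right_module_move[where Pr = "\<lambda>x. x \<in> S"]) (use that w in auto)
  have "?P (m * z * w) \<and> ?P (m * z * w')"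
    by (rule right_module_move[where Pr = ?P, OF _ _ P w])
      (use assms in \<open>auto simp: absorbs_def distrib_right scale_mult_left\<close>)
  then show ?thesis by (auto simp: absorbs_def)
qed

lemma absorbs_gens:
  assumes "(w, w') = (a', c) \<and> (u, u') = (a, c') \<or> (w, w') = (a, c') \<and> (u, u') = (a', c)"
    and "v1 \<in> {u, u'}" "v2 \<in> {u, u'}"
  shows "absorbs w w' (v1 * v2)"
proof -
  have 1: "a * c \<in> S" "c' * a' \<in> S" "c' * c \<in> S"
    using S_A S_B S_B' unfolding A_def B'_def by (simp_all only: B_def)
  moreover have "a * a' = 1 - Q^2 *s (c' * c)" "a' * a = 1 - c' * c" "c * a = (1 / Q) *s (a * c)"
    "a' * c' = (1 / Q) *s (c' * a')" "c * c' = c' * c"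
    by (simp_all add: su2_relations)
  ultimately have "a * a' \<in> S" "a' * a \<in> S" "c * a \<in> S" "a' * c' \<in> S" "c * c' \<in> S"
    by (metis S_1 S_diff S_scale)+
  with 1 have U: "v * x \<in> S" if "v \<in> {u, u'}" "x \<in> {w, w'}" for v x
    using assms(1) that by auto
  show ?thesis
    unfolding absorbs_def
  proof (intro ballI)
    fix x y assume xy: "x \<in> {w, w'}" "y \<in> {w, w'}"
    have "v1 * (v2 * x) * w \<in> S \<and> v1 * (v2 * x) * w' \<in> S"
      by (rule right_module_move[where Pr = "\<lambda>x. x \<in> S"]) (use assms U xy in auto)
    then show "v1 * v2 * x * y \<in> S" using xy by (auto simp: mult.assoc)
  qed
qed

end

context podles_haar
begin

lemmas absorbs_pairs = absorbs_gens[of a' c a c', simplified] absorbs_gens[of a c' a' c, simplified]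

lemma absorbs_0: "absorbs w w' 0"
  by (simp add: absorbs_def)

lemma absorbs_E: "y \<in> S \<Longrightarrow> absorbs a' c (E y)"
proof (induction rule: S_induct)
  case (mult x y)
  then show ?case by (simp add: E_derivation absorbs_closed absorbs_mult)
qed (simp_all add: E_A E_B E_B' act_E_1 act.add act.scale absorbs_closed absorbs_pairs absorbs_0 del: scale_minus_left)

lemma absorbs_F: "y \<in> S \<Longrightarrow> absorbs a c' (F y)"
proof (induction rule: S_induct)
  case (mult x y)
  then show ?case by (simp add: F_derivation absorbs_closed absorbs_mult)
qed (simp_all add: F_A F_B F_B' act_F_1 act.add act.scale absorbs_closed absorbs_pairs absorbs_0 del: scale_minus_left)

lemma absorbs_mult_F: "y \<in> S \<Longrightarrow> absorbs a' c m \<Longrightarrow> m * F y \<in> S"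
proof (induction arbitrary: m rule: S_induct)
  case (mult x y)
  then have "m * F x * y + m * x * F y \<in> S" by (simp add: absorbs_mult)
  with mult show ?case by (simp add: F_derivation distrib_left mult.assoc)
qed (simp_all add: F_A F_B F_B' act_F_1 act.add act.scale distrib_left scale_mult_right absorbs_def
      del: scale_minus_left flip: mult.assoc)

lemma absorbs_mult_E: "y \<in> S \<Longrightarrow> absorbs a c' m \<Longrightarrow> m * E y \<in> S"
proof (induction arbitrary: m rule: S_induct)
  case (mult x y)
  then have "m * E x * y + m * x * E y \<in> S" by (simp add: absorbs_mult)
  with mult show ?case by (simp add: E_derivation distrib_left mult.assoc)
qed (simp_all add: E_A E_B E_B' act_E_1 act.add act.scale distrib_left scale_mult_right absorbs_def
      del: scale_minus_left flip: mult.assoc)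

lemma E_F_S [simp]: "x \<in> S \<Longrightarrow> y \<in> S \<Longrightarrow> E x * F y \<in> S" and F_E_S [simp]: "x \<in> S \<Longrightarrow> y \<in> S \<Longrightarrow> F x * E y \<in> S"
  and E_f_S [simp]: "x \<in> S \<Longrightarrow> E x * f \<in> S" and F_e_S [simp]: "x \<in> S \<Longrightarrow> F x * e \<in> S"
  using absorbs_mult_F absorbs_E absorbs_mult_E absorbs_F
  by (auto simp: absorbs_def simp flip: mult.assoc)

lemma K_E: "y \<in> S \<Longrightarrow> act UK (E y) = (1 / Q) *s E y" and K_F: "y \<in> S \<Longrightarrow> act UK (F y) = Q *s F y"
proof -
  show "act UK (E y) = (1 / Q) *s E y" if "y \<in> S"
    using that
  proof (induction rule: S_induct)
    case (mult x y)
    then show ?case by (simp add: E_derivation act.add act_K_mult act_K_S linear_simps)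
  next
    case (scale z x)
    then show ?case by (simp add: act.scale mult.commute)
  qed (simp_all add: E_A E_B E_B' act_E_1 act.zero act.add act.scale act.neg scale_right_distrib act_K linear_simps field_simps)
  show "act UK (F y) = Q *s F y" if "y \<in> S"
    using that
  proof (induction rule: S_induct)
    case (mult x y)
    then show ?case by (simp add: F_derivation act.add act_K_mult act_K_S linear_simps)
  next
    case (scale z x)
    then show ?case by (simp add: act.scale mult.commute)
  qed (simp_all add: F_A F_B F_B' act_F_1 act.zero act.add act.scale act.neg scale_right_distrib act_K linear_simps field_simps)
qed

lemma Ki_E: "y \<in> S \<Longrightarrow> act UKi (E y) = Q *s E y" and Ki_F: "y \<in> S \<Longrightarrow> act UKi (F y) = (1 / Q) *s F y"
  using act_Ki_eigen[OF K_E[of y]] act_Ki_eigen[OF K_F[of y]] by simp_all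

lemma E_F_commute: "y \<in> S \<Longrightarrow> E (F y) = F (E y)"
proof (induction rule: S_induct)
  case (mult x y)
  then show ?case
    by (simp add: E_derivation F_derivation act.add act_E_mult act_F_mult K_E K_F Ki_E Ki_F act_K_S act_Ki_S linear_simps)
next
  case A
  show ?case
    by (simp add: E_A F_A act.scale act.neg act_E act_F act_K act_Ki_gen linear_simps normal_order power2_eq_square)
qed (simp_all add: E_B F_B E_B' F_B' act_E_1 act_F_1 act.zero act.add act.scale act.neg act_E act_F act_K act_Ki_gen normal_order)

text \<open>This is \<open>\<tau>(1, x, y) = 0\<close>. By the invariance of \<open>h\<close> under \<open>E\<close> and \<open>F\<close> (integration by parts), both
sides are multiples of \<open>h(x F(E(y)))\<close>.\<close>

lemma haar_F_E: "x \<in> S \<Longrightarrow> y \<in> S \<Longrightarrow> h (F x * E y) = Q^2 * h (E x * F y)"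
proof -
  assume xy: "x \<in> S" "y \<in> S"
  have "0 = (1 / Q) * h (F x * E y) + h (x * F (E y))"
    using haar_EF[of UF "x * E y"] by (simp add: F_mult xy K_E h_add h_scale scale_mult_right)
  moreover have "0 = Q * h (E x * F y) + h (x * F (E y))"
    using haar_EF[of UE "x * F y"] by (simp add: E_mult xy K_F h_add h_scale scale_mult_right E_F_commute)
  ultimately have "(1 / Q) * h (F x * E y) = Q * h (E x * F y)" by (metis add_right_cancel)
  then show ?thesis by (simp add: field_simps power2_eq_square)
qed

end

section \<open>Twisted commutators\<close>

locale podles_twisted = podles_haar scale q star a c act h
  for scale :: "complex \<Rightarrow> 'a::ring_1 \<Rightarrow> 'a" and q star a c act h +
  fixes \<sigma> :: "'a \<Rightarrow> 'a" and hA :: "'a \<Rightarrow> complex"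
  assumes sigma: "is_podles_sigma scale q star a c \<sigma>" and hA: "is_podles_hA scale q star a c hA"
begin

lemma twist_sigma: "twist (Q^2) \<sigma>"
proof -
  have "\<sigma> A = A" "\<sigma> B = Q^2 *s B" "\<sigma> B' = (1 / Q^2) *s B'"
    and auto: "algebra_automorphism_on scale S \<sigma>"
    using sigma by (simp_all add: is_podles_sigma_def)
  moreover have "\<forall>x\<in>S. \<sigma> x \<in> S"
    using auto by (auto simp: algebra_automorphism_on_def bij_betw_def)
  ultimately show ?thesis
    by (simp add: twist_def algebra_automorphism_on_def)
qed

lemma sigma_S [simp]: "x \<in> S \<Longrightarrow> \<sigma> x \<in> S" and sigma_1 [simp]: "\<sigma> 1 = 1"
  and sigma_add: "x \<in> S \<Longrightarrow> y \<in> S \<Longrightarrow> \<sigma> (x + y) = \<sigma> x + \<sigma> y"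
  and sigma_mult: "x \<in> S \<Longrightarrow> y \<in> S \<Longrightarrow> \<sigma> (x * y) = \<sigma> x * \<sigma> y"
  and sigma_scale: "x \<in> S \<Longrightarrow> \<sigma> (k *s x) = k *s \<sigma> x"
  and sigma_A [simp]: "\<sigma> A = A" and sigma_B: "\<sigma> B = Q^2 *s B" and sigma_B': "\<sigma> B' = (1 / Q^2) *s B'"
  using twist_sigma by (simp_all add: twist_def)

lemma sigma_diff: "x \<in> S \<Longrightarrow> y \<in> S \<Longrightarrow> \<sigma> (x - y) = \<sigma> x - \<sigma> y"
  using sigma_add[of "x - y" y] by simp

lemma hA_functional: "linear_functional_on scale S hA" and hA_1: "hA 1 = 0" and hA_A: "hA A = 1"
  and hA_twisted: "x \<in> S \<Longrightarrow> y \<in> S \<Longrightarrow> hA (x * y) = hA (\<sigma> y * x)"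
proof -
  show lin: "linear_functional_on scale S hA" and "hA 1 = 0"
    using hA by (simp_all add: is_podles_hA_def)
  have B: "hA (A ^ r * B ^ Suc m) = 0" "hA (A ^ r * B' ^ Suc m) = 0" for r m
    using hA by (simp_all only: is_podles_hA_def zero_less_Suc)
  have A: "hA (A ^ Suc r) = (1 - Q^4) / (1 - Q^(2*r) * Q^4)" for r
    using hA by (simp add: is_podles_hA_def power_add)
  have Q: "Q ^ (2*r) * Q^4 \<noteq> 1" for r
    using Q_power_neq_1[of "2*r + 4"] by (simp only: power_add) simp
  show "hA A = 1" using A[of 0] Q[of 0] by simp
  show "hA (x * y) = hA (\<sigma> y * x)" if "x \<in> S" "y \<in> S"
  proof (rule twisted_trace[OF lin B _ twist_sigma that])
    fix r
    have "Q^2 * Q^(2*r) * Q^2 = Q^(2*r) * Q^4" "Q^2 * Q^(2*r) * Q^4 = Q^(2 * Suc r) * Q^4"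
      by (simp_all add: eval_nat_numeral mult.commute mult.left_commute)
    with twisted_trace_recursion[of "Q^2 * Q^(2*r)" "1 - Q^4"]
    show "Q^2 * Q^(2*r) * (Q^2 * hA (A ^ Suc r) - Q^4 * hA (A ^ Suc (Suc r))) =
        hA (A ^ Suc r) - hA (A ^ Suc (Suc r))"
      unfolding A using Q[of r] Q[of "Suc r"] by simp
  qed
qed

lemma Tr_sigma: "x \<in> S \<Longrightarrow> Tr (\<sigma> x) = Tr x"
proof (rule functional_eqI[where T = "\<lambda>x. Tr (\<sigma> x)"])
  show "linear_functional_on scale S (\<lambda>x. Tr (\<sigma> x))"
    by (simp add: linear_functional_on_def sigma_add sigma_scale Tr_add Tr_scale)
  have pow: "\<sigma> (x ^ n) = \<sigma> x ^ n" if "x \<in> S" for x n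
    by (induction n) (use that in \<open>simp_all add: sigma_mult\<close>)
  have scale_pow: "(k *s x) ^ n = k ^ n *s x ^ n" for k x n
    by (induction n) (simp_all add: linear_simps mult.commute)
  show "Tr (\<sigma> (A ^ r)) = Tr (A ^ r)" for r by (simp add: pow)
  show "Tr (\<sigma> (A ^ r * B ^ Suc m)) = Tr (A ^ r * B ^ Suc m)" for r m
    unfolding sigma_mult[OF S_power[OF S_A] S_power[OF S_B]] pow[OF S_A] pow[OF S_B] sigma_A sigma_B
      scale_pow scale_mult_right Tr_scale Tr_B by simp
  show "Tr (\<sigma> (A ^ r * B' ^ Suc m)) = Tr (A ^ r * B' ^ Suc m)" for r m
    unfolding sigma_mult[OF S_power[OF S_A] S_power[OF S_B']] pow[OF S_A] pow[OF S_B'] sigma_A sigma_B'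
      scale_pow scale_mult_right Tr_scale Tr_B' by simp
qed (rule Tr_functional)

lemma A_sigma: "x \<in> S \<Longrightarrow> A * \<sigma> x = x * A"
proof (induction rule: S_induct)
  case (mult x y)
  then show ?case by (simp add: sigma_mult mult.assoc) (simp add: mult.assoc flip: mult.assoc[of A])
qed (simp_all add: sigma_B sigma_B' sigma_add sigma_scale podles_relations linear_simps)

text \<open>The constants of the twisted commutators below: \<open>- (1 - q\<^sup>2) q\<^sup>-\<^sup>5\<^sup>/\<^sup>2\<close> and \<open>- (1 - q\<^sup>2) q\<^sup>1\<^sup>/\<^sup>2\<close>.\<close>

definition "kE = - ((1 - Q^2) / (Q^2 * s))"
definition "kF = - ((1 - Q^2) * s)"

text \<open>If \<open>D\<close> is a derivation, then \<open>y \<mapsto> D(y) A\<close> obeys the product rule of the twisted commutator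
\<open>y \<mapsto> w \<sigma>(y) - y w\<close>, because \<open>z A = A \<sigma>(z)\<close>. Hence the two need to be compared on generators only.\<close>

lemma twisted_commutator_mult:
  assumes "D (x * y) = D x * y + x * D y" "x \<in> S" "y \<in> S"
    "w * \<sigma> x = x * w + k *s (D x * A)" "w * \<sigma> y = y * w + k *s (D y * A)"
  shows "w * \<sigma> (x * y) = x * y * w + k *s (D (x * y) * A)"
proof -
  have "w * \<sigma> (x * y) = (w * \<sigma> x) * \<sigma> y" by (simp only: sigma_mult assms(2,3) mult.assoc)
  also have "\<dots> = x * (w * \<sigma> y) + k *s (D x * (A * \<sigma> y))"
    unfolding assms(4) by (simp add: linear_simps)
  also have "\<dots> = x * y * w + k *s (D (x * y) * A)"
    unfolding assms A_sigma[OF assms(3)] by (simp add: linear_simps)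
  finally show ?thesis .
qed

lemma E_commutator: "y \<in> S \<Longrightarrow> e * \<sigma> y = y * e + kE *s (E y * A)"
proof (induction rule: S_induct)
  case (mult x y)
  then show ?case by (intro twisted_commutator_mult E_derivation)
next
  case (add x y)
  then show ?case by (simp add: sigma_add act.add distrib_left distrib_right scale_right_distrib)
next
  case (scale z x)
  then show ?case by (simp add: sigma_scale act.scale linear_simps mult.commute)
next
  case A
  have "e * A = Q^2 *s (A * e)" by (simp add: podles_defs normal_order power2_eq_square)
  moreover have "kE * (s * Q^2) = Q^2 - 1" by (simp add: kE_def field_simps)
  ultimately show ?case by (simp add: E_A scale_mult_left scale_left_diff_distrib)
next
  case B
  let ?X = "A * (a * a)"
  have "e * B = Q^2 *s ?X" "B * e = Q^2 *s ?X" "a * a * A = Q^4 *s ?X"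
    by (simp_all add: podles_defs normal_order power2_eq_square power4_eq_xxxx mult.assoc)
  moreover have "kE * (s * Q^4) = Q^2 * Q^2 - Q^2"
    by (simp add: kE_def field_simps power2_eq_square power4_eq_xxxx)
  ultimately show ?case by (simp add: sigma_B E_B linear_simps scale_left_diff_distrib)
next
  case B'
  let ?X = "c' * c'" and ?Y = "c' * c' * A"
  have "e * B' = Q *s ?X - Q^3 *s ?Y" "B' * e = (1 / Q) *s ?X - (1 / Q) *s ?Y"
    by (simp_all add: podles_defs normal_order power2_eq_square power4_eq_xxxx mult.assoc power3_eq_cube)
  moreover have "- (1 / Q) + - (kE * (Q * s)) = - Q" by (simp add: kE_def field_simps power2_eq_square)
  ultimately show ?case
    using scale_left_distrib[of "- (1 / Q)" "- (kE * (Q * s))" ?Y]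
    by (simp add: sigma_B' E_B' linear_simps power2_eq_square power3_eq_cube)
qed (simp_all add: act_E_1)

lemma F_commutator: "y \<in> S \<Longrightarrow> f * \<sigma> y = y * f + kF *s (F y * A)"
proof (induction rule: S_induct)
  case (mult x y)
  then show ?case by (intro twisted_commutator_mult F_derivation)
next
  case (add x y)
  then show ?case by (simp add: sigma_add act.add distrib_left distrib_right scale_right_distrib)
next
  case (scale z x)
  then show ?case by (simp add: sigma_scale act.scale linear_simps mult.commute)
next
  case A
  have "f * A = (1 / Q^2) *s (A * f)" by (simp add: podles_defs normal_order power2_eq_square)
  moreover have "kF * s / (Q * Q^2) = 1 - 1 / Q^2" by (simp add: kF_def field_simps)
  ultimately show ?case by (simp add: F_A scale_mult_left scale_left_diff_distrib)
next
  case B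
  let ?X = "c * c" and ?Y = "c * c * A"
  have "f * B = (1 / Q) *s ?X - (1 / Q) *s ?Y" "B * f = Q *s ?X - Q^3 *s ?Y"
    by (simp_all add: podles_defs normal_order power2_eq_square power4_eq_xxxx mult.assoc power3_eq_cube)
  moreover have "- (Q^3) + kF * s = - Q" by (simp add: kF_def field_simps power2_eq_square power3_eq_cube)
  ultimately show ?case
    using scale_left_distrib[of "- (Q^3)" "kF * s" ?Y]
    by (simp add: sigma_B F_B linear_simps power2_eq_square power3_eq_cube)
next
  case B'
  let ?X = "A * (a' * a')"
  have "f * B' = (1 / Q^2) *s ?X" "B' * f = (1 / Q^2) *s ?X" "a' * a' * A = (1 / Q^4) *s ?X"
    by (simp_all add: podles_defs normal_order power2_eq_square power4_eq_xxxx mult.assoc)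
  moreover have "kF * s / (Q * Q^4) = 1 / Q^2 - 1 / Q^2 * (1 / Q^2)"
    by (simp add: kF_def field_simps power2_eq_square power4_eq_xxxx)
  ultimately show ?case
    by (simp add: sigma_B' F_B' linear_simps scale_left_diff_distrib)
qed (simp_all add: act_F_1)

section \<open>The primitive of \<open>\<tau>\<close> and its symmetrisation\<close>

text \<open>The second factor of \<open>\<psi>\<close>. It arises from \<open>\<partial>\<^sub>F(y) \<partial>\<^sub>E(z) - q\<^sup>2 \<partial>\<^sub>E(y) \<partial>\<^sub>F(z)\<close> when \<open>\<partial>\<^sub>E\<close> and \<open>\<partial>\<^sub>F\<close>, applied to
\<open>z\<close>, are replaced, up to constants, by the elements \<open>e\<close> and \<open>f\<close> that implement them as twisted commutators.\<close>

definition Z :: "'a \<Rightarrow> 'a" where "Z y = E y * f - Q *s (F y * e)"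

definition \<psi> :: "'a \<Rightarrow> 'a \<Rightarrow> complex" where "\<psi> x y = Q * s * Tr (x * Z y)"

lemma Z_S [simp]: "y \<in> S \<Longrightarrow> Z y \<in> S"
  by (simp add: Z_def)

lemma Z_linear: "Z (x + y) = Z x + Z y" "Z (k *s x) = k *s Z x"
  by (simp_all add: Z_def act.add act.scale distrib_right linear_simps mult.commute)

lemma Z_sigma:
  assumes "y \<in> S" "z \<in> S"
  shows "Z y * \<sigma> z = E y * z * f - Q *s (F y * z * e) + kF *s (E y * F z * A) - (Q * kE) *s (F y * E z * A)"
proof -
  have "Z y * \<sigma> z = E y * (f * \<sigma> z) - Q *s (F y * (e * \<sigma> z))"
    by (simp add: Z_def linear_simps)
  then show ?thesis
    unfolding E_commutator[OF assms(2)] F_commutator[OF assms(2)] by (simp add: linear_simps)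
qed

lemma Z_mult:
  assumes "y \<in> S" "z \<in> S"
  shows "Z (y * z) = y * Z z + (E y * z * f - Q *s (F y * z * e))"
  using assms by (simp add: Z_def E_derivation F_derivation linear_simps)

lemma trace_constants:
  "Q * s * kF / (1 - Q^2) = - (Q^2)" "Q * s * (Q * kE) / (1 - Q^2) = - 1"
  using Q_power_neq_1[of 2] by (simp_all add: kE_def kF_def field_simps power2_eq_square)

lemma Tr_EF:
  assumes "x \<in> S" "y \<in> S" "z \<in> S"
  shows "Q * s * Tr (x * (kF *s (E y * F z * A) - (Q * kE) *s (F y * E z * A))) =
    h (x * (F y * E z - Q^2 *s (E y * F z)))"
proof -
  have "x * (kF *s (E y * F z * A) - (Q * kE) *s (F y * E z * A)) =
      kF *s (x * (E y * F z) * A) - (Q * kE) *s (x * (F y * E z) * A)"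
    by (simp add: linear_simps)
  then have "Q * s * Tr (x * (kF *s (E y * F z * A) - (Q * kE) *s (F y * E z * A))) =
      (Q * s * kF / (1 - Q^2)) * h (x * (E y * F z)) - (Q * s * (Q * kE) / (1 - Q^2)) * h (x * (F y * E z))"
    using assms by (simp only: Tr_diff Tr_scale Tr_mult_A S_mult E_F_S F_E_S) (simp add: right_diff_distrib mult.assoc)
  then show ?thesis
    unfolding trace_constants by (simp add: linear_simps h_diff h_scale)
qed

text \<open>In \<open>b\<^sub>\<sigma> \<psi>\<close> the derivation rule cancels all terms except those with \<open>e\<close> or \<open>f\<close> to the left of \<open>\<sigma>(z)\<close> or
to the right of \<open>z\<close>; they combine to twisted commutators, that is to \<open>\<partial>\<^sub>E(z) A\<close> and \<open>\<partial>\<^sub>F(z) A\<close>. The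
factor \<open>A\<close> then turns \<open>Tr\<close> into \<open>h\<close>.\<close>

lemma coboundary_\<psi>:
  assumes "x \<in> S" "y \<in> S" "z \<in> S"
  shows "\<psi> (x * y) z - \<psi> x (y * z) + \<psi> (\<sigma> z * x) y = h (x * (F y * E z - Q^2 *s (E y * F z)))"
proof -
  have "Tr (\<sigma> z * x * Z y) = Tr (x * (Z y * \<sigma> z))"
    using Tr_commute[of "\<sigma> z" "x * Z y"] assms by (simp add: mult.assoc)
  then have "\<psi> (x * y) z - \<psi> x (y * z) + \<psi> (\<sigma> z * x) y =
      Q * s * Tr (x * y * Z z - x * Z (y * z) + x * (Z y * \<sigma> z))"
    by (simp add: \<psi>_def Tr_add Tr_diff distrib_left right_diff_distrib)
  also have "x * y * Z z - x * Z (y * z) + x * (Z y * \<sigma> z) =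
      x * (kF *s (E y * F z * A) - (Q * kE) *s (F y * E z * A))"
    unfolding Z_mult[OF assms(2,3)] Z_sigma[OF assms(2,3)] by (simp add: linear_simps)
  finally show ?thesis unfolding Tr_EF[OF assms] .
qed

definition \<phi> :: "'a \<Rightarrow> complex" where "\<phi> x = Q * s * Tr (Z x)"

text \<open>The same cancellation as in \<open>coboundary_\<psi>\<close>, with the remainder \<open>\<tau>(1, x, y) = 0\<close>.\<close>

lemma \<psi>_symmetrised:
  assumes "x \<in> S" "y \<in> S"
  shows "\<psi> x y + \<psi> (\<sigma> y) x = \<phi> (x * y)"
proof -
  have "Tr (\<sigma> y * Z x) = Tr (Z x * \<sigma> y)"
    using Tr_commute[of "\<sigma> y" "Z x"] assms by simp
  then have "\<psi> x y + \<psi> (\<sigma> y) x = Q * s * Tr (x * Z y + Z x * \<sigma> y)"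
    by (simp add: \<psi>_def Tr_add distrib_left)
  also have "x * Z y + Z x * \<sigma> y =
      Z (x * y) + 1 * (kF *s (E x * F y * A) - (Q * kE) *s (F x * E y * A))"
    unfolding Z_mult[OF assms] Z_sigma[OF assms] by simp
  also have "Q * s * Tr \<dots> = \<phi> (x * y) + h (1 * (F x * E y - Q^2 *s (E x * F y)))"
    unfolding Tr_add distrib_left Tr_EF[OF S_1 assms] by (simp add: \<phi>_def)
  also have "h (1 * (F x * E y - Q^2 *s (E x * F y))) = 0"
    using haar_F_E[OF assms] by (simp add: h_diff h_scale)
  finally show ?thesis by simp
qed

lemma Z_gens:
  "Z A = s *s ((A - Q^2 *s (A * A)) + (1 / Q^2) *s (A - A * A))"
  "Z B = s *s (B - (Q^4 + 1) *s (A * B))"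
  "Z B' = s *s ((1 / Q^2) *s B' - (1 / Q^4 + 1) *s (A * B'))"
proof -
  have "e * f = A - Q^2 *s (A * A)" "f * e = (1 / Q^2) *s (A - A * A)"
    by (simp_all add: podles_defs normal_order power2_eq_square)
  then show "Z A = s *s ((A - Q^2 *s (A * A)) + (1 / Q^2) *s (A - A * A))"
    by (simp add: Z_def E_A F_A scale_mult_left scale_right_distrib)
  have "a * a * f = B - Q^4 *s (A * B)" "Q *s (c * c * e) = A * B"
    by (simp_all add: podles_defs normal_order power2_eq_square power4_eq_xxxx mult.assoc)
  moreover have "Z B = s *s (a * a * f - Q *s (c * c * e))"
    by (simp add: Z_def E_B F_B linear_simps mult.commute)
  ultimately show "Z B = s *s (B - (Q^4 + 1) *s (A * B))"
    by (simp add: scale_left_distrib)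
  have "a' * a' * e = (1 / Q^2) *s B' - (1 / Q^4) *s (A * B')" "Q *s (c' * c' * f) = A * B'"
    by (simp_all add: podles_defs normal_order power2_eq_square power4_eq_xxxx mult.assoc)
  moreover have "Z B' = s *s (a' * a' * e - Q *s (c' * c' * f))"
    by (simp add: Z_def E_B' F_B' linear_simps mult.commute)
  ultimately show "Z B' = s *s ((1 / Q^2) *s B' - (1 / Q^4 + 1) *s (A * B'))"
    by (simp add: scale_left_distrib)
qed

lemma sigma_Z_gens: "\<sigma> (Z A) = Z A" "\<sigma> (Z B) = Q^2 *s Z B" "\<sigma> (Z B') = (1 / Q^2) *s Z B'"
  unfolding Z_gens
  by (simp_all add: sigma_add sigma_diff sigma_scale sigma_mult sigma_B sigma_B' linear_simps mult.commute)

lemma \<psi>_sigma: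
  assumes "x \<in> S" "g \<in> S" "\<sigma> (Z g) = k *s Z g"
  shows "\<psi> x g = k * \<psi> (\<sigma> x) g"
proof -
  have "Tr (x * Z g) = Tr (\<sigma> x * \<sigma> (Z g))"
    using Tr_sigma[of "x * Z g"] assms by (simp add: sigma_mult)
  then show ?thesis by (simp add: \<psi>_def assms(3) scale_mult_right Tr_scale)
qed

lemma \<psi>_scale: "\<psi> (k *s x) y = k * \<psi> x y" "\<psi> x (k *s y) = k * \<psi> x y"
  and \<psi>_add: "\<psi> (x + x') y = \<psi> x y + \<psi> x' y" "\<psi> x (y + y') = \<psi> x y + \<psi> x y'"
  by (simp_all add: \<psi>_def Z_linear linear_simps Tr_scale Tr_add distrib_left)

text \<open>As \<open>Tr\<close> is \<open>\<sigma>\<close>-invariant and \<open>Z g\<close> has the same \<open>\<sigma>\<close>-eigenvalue as the generator \<open>g\<close>, the symmetrised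
cochain is \<open>\<sigma>\<close>-twisted symmetric in \<open>x\<close> and \<open>g\<close>.\<close>

lemma \<phi>_twisted:
  assumes "x \<in> S" "g \<in> S" "\<sigma> g = k *s g" "\<sigma> (Z g) = k *s Z g"
  shows "\<phi> (x * g) = k * \<phi> (g * x)"
proof -
  have "\<phi> (x * g) = \<psi> x g + k * \<psi> g x"
    using \<psi>_symmetrised[OF assms(1,2)] by (simp add: assms(3) \<psi>_scale)
  also have "\<dots> = k * (\<psi> g x + \<psi> (\<sigma> x) g)"
    using \<psi>_sigma[OF assms(1,2,4)] by (simp add: distrib_left)
  also have "\<dots> = k * \<phi> (g * x)"
    using \<psi>_symmetrised[OF assms(2,1)] by simp
  finally show ?thesis .
qed

definition "\<beta> = Q^2 / (1 - Q^4)"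

lemma \<beta>_neq_0: "\<beta> \<noteq> 0"
  using Q_power_neq_1[of 4] by (simp add: \<beta>_def)

lemma \<phi>_A: "\<phi> A = 2 * \<beta>"
proof -
  have Q4: "1 - Q^4 = (1 - Q^2) * (1 + Q^2)"
    by (simp add: algebra_simps power2_eq_square power4_eq_xxxx)
  moreover have "1 - Q^4 \<noteq> 0" using Q_power_neq_1[of 4] by simp
  ultimately have Q2: "1 / (1 - Q^2) = (1 + Q^2) / (1 - Q^4)" by simp
  have "Tr (A * A) = 1 / (1 - Q^4)" "Tr A = 1 / (1 - Q^2)"
    using Tr_A[of 1] Tr_A[of 0] by (simp_all add: eval_nat_numeral)
  then have "\<phi> A = Q * s * (s * ((1 / (1 - Q^2) - Q^2 * (1 / (1 - Q^4))) +
      (1 / Q^2) * (1 / (1 - Q^2) - 1 / (1 - Q^4))))"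
    by (simp only: \<phi>_def Z_gens Tr_scale Tr_add Tr_diff)
  also have "1 / (1 - Q^2) - Q^2 * (1 / (1 - Q^4)) = 1 / (1 - Q^4)"
    unfolding Q2 by (simp add: add_divide_distrib)
  also have "1 / (1 - Q^2) - 1 / (1 - Q^4) = Q^2 / (1 - Q^4)"
    unfolding Q2 by (simp add: add_divide_distrib)
  finally show ?thesis by (simp add: \<beta>_def power2_eq_square)
qed

lemma Z_1 [simp]: "Z 1 = 0"
  by (simp add: Z_def act_E_1 act_F_1)

text \<open>Both sides are \<open>\<sigma>\<close>-twisted traces with the values \<open>0\<close> at \<open>1\<close> and \<open>2 \<beta>\<close> at \<open>A\<close>.\<close>

lemma \<phi>_eq: "x \<in> S \<Longrightarrow> \<phi> x = 2 * \<beta> * hA x"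
proof -
  assume x: "x \<in> S"
  let ?T = "\<lambda>x. \<phi> x - 2 * \<beta> * hA x"
  have "?T x = 0"
  proof (rule twisted_trace_unique[of ?T, OF _ _ _ _ _ _ x])
    show "linear_functional_on scale S ?T"
      by (simp add: linear_functional_on_def \<phi>_def Z_linear Tr_add Tr_scale functional_simps[OF hA_functional] algebra_simps)
    show "?T 1 = 0" using Tr_scale[of 0 0] by (simp add: \<phi>_def hA_1)
    show "?T A = 0" by (simp add: \<phi>_A hA_A)
    fix y assume y: "y \<in> S"
    show "?T (y * A) = ?T (A * y)"
      using \<phi>_twisted[of y A 1] hA_twisted[OF y S_A] y by (simp add: sigma_Z_gens)
    show "?T (y * B) = Q^2 * ?T (B * y)"
      using \<phi>_twisted[of y B "Q^2"] hA_twisted[OF y S_B] y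
      by (simp add: sigma_Z_gens sigma_B scale_mult_left functional_simps[OF hA_functional] algebra_simps)
    show "?T (y * B') = (1 / Q^2) * ?T (B' * y)"
      using \<phi>_twisted[of y B' "1 / Q^2"] hA_twisted[OF y S_B'] y
      by (simp add: sigma_Z_gens sigma_B' scale_mult_left functional_simps[OF hA_functional] diff_divide_distrib)
  qed
  then show ?thesis by simp
qed

end

section \<open>Low-dimensional twisted cyclic cochains\<close>

context quantum_SU2
begin

lemma tuples_simps:
  "as \<in> tuples S 0 \<longleftrightarrow> (\<exists>x\<in>S. as = [x])"
  "as \<in> tuples S 1 \<longleftrightarrow> (\<exists>x\<in>S. \<exists>y\<in>S. as = [x, y])"
  "as \<in> tuples S 2 \<longleftrightarrow> (\<exists>x\<in>S. \<exists>y\<in>S. \<exists>z\<in>S. as = [x, y, z])"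
  "as \<in> tuples S 3 \<longleftrightarrow> (\<exists>w\<in>S. \<exists>x\<in>S. \<exists>y\<in>S. \<exists>z\<in>S. as = [w, x, y, z])"
  by (auto simp: tuples_def length_Suc_conv numeral_eq_Suc)

lemma twisted_coboundary_simps:
  "twisted_coboundary \<rho> 0 \<phi> [x, y] = \<phi> [x * y] - \<phi> [\<rho> y * x]"
  "twisted_coboundary \<rho> 1 \<phi> [x, y, z] = \<phi> [x * y, z] - \<phi> [x, y * z] + \<phi> [\<rho> z * x, y]"
  "twisted_coboundary \<rho> 2 \<phi> [w, x, y, z] =
    \<phi> [w * x, y, z] - \<phi> [w, x * y, z] + \<phi> [w, x, y * z] - \<phi> [\<rho> z * w, x, y]"
  by (simp_all add: twisted_coboundary_def eval_nat_numeral)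

abbreviation "lin \<equiv> linear_functional_on scale S"

lemma ball_tuples:
  "(\<forall>as\<in>tuples S 0. P as) \<longleftrightarrow> (\<forall>x\<in>S. P [x])"
  "(\<forall>as\<in>tuples S 1. P as) \<longleftrightarrow> (\<forall>x\<in>S. \<forall>y\<in>S. P [x, y])"
  "(\<forall>as\<in>tuples S 2. P as) \<longleftrightarrow> (\<forall>x\<in>S. \<forall>y\<in>S. \<forall>z\<in>S. P [x, y, z])"
  "(\<forall>as\<in>tuples S 3. P as) \<longleftrightarrow> (\<forall>w\<in>S. \<forall>x\<in>S. \<forall>y\<in>S. \<forall>z\<in>S. P [w, x, y, z])"
  unfolding Ball_def tuples_simps by blast+

lemma all_le_simps:
  "(\<forall>i\<le>0::nat. P i) \<longleftrightarrow> P 0" "(\<forall>i\<le>1::nat. P i) \<longleftrightarrow> P 0 \<and> P 1"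
  "(\<forall>i\<le>2::nat. P i) \<longleftrightarrow> P 0 \<and> P 1 \<and> P 2"
  by (auto simp: le_Suc_eq numeral_2_eq_2)

lemma cyclic_cochains_0:
  "\<phi> \<in> cyclic_cochains scale S \<rho> 0 \<longleftrightarrow> (\<forall>x\<in>S. lin (\<lambda>x. \<phi> [x])) \<and> (\<forall>x\<in>S. \<phi> [x] = \<phi> [\<rho> x])"
  unfolding cyclic_cochains_def multilinear_on_def ball_tuples all_le_simps by simp

lemma cyclic_cochains_1:
  "\<phi> \<in> cyclic_cochains scale S \<rho> 1 \<longleftrightarrow>
    (\<forall>x\<in>S. \<forall>y\<in>S. lin (\<lambda>x. \<phi> [x, y]) \<and> lin (\<lambda>y. \<phi> [x, y])) \<and>
    (\<forall>x\<in>S. \<forall>y\<in>S. \<phi> [x, y] = - \<phi> [\<rho> y, x])"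
  unfolding cyclic_cochains_def multilinear_on_def mem_Collect_eq ball_tuples all_le_simps by simp

lemma cyclic_cochains_2:
  "\<phi> \<in> cyclic_cochains scale S \<rho> 2 \<longleftrightarrow>
    (\<forall>x\<in>S. \<forall>y\<in>S. \<forall>z\<in>S.
      lin (\<lambda>x. \<phi> [x, y, z]) \<and> lin (\<lambda>y. \<phi> [x, y, z]) \<and> lin (\<lambda>z. \<phi> [x, y, z])) \<and>
    (\<forall>x\<in>S. \<forall>y\<in>S. \<forall>z\<in>S. \<phi> [x, y, z] = \<phi> [\<rho> z, x, y])"
  unfolding cyclic_cochains_def multilinear_on_def mem_Collect_eq ball_tuples all_le_simps
  by (simp add: numeral_2_eq_2)

lemma cyclic_cocycles_0:
  "\<phi> \<in> cyclic_cocycles scale S \<rho> 0 \<longleftrightarrow>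
    \<phi> \<in> cyclic_cochains scale S \<rho> 0 \<and> (\<forall>x\<in>S. \<forall>y\<in>S. \<phi> [x * y] = \<phi> [\<rho> y * x])"
proof -
  have "tuples S (0 + 1) = tuples S 1" by simp
  then show ?thesis
    unfolding cyclic_cocycles_def mem_Collect_eq
    by (simp only: ball_tuples twisted_coboundary_simps eq_iff_diff_eq_0[symmetric])
qed

lemma cyclic_cocycles_2:
  "\<phi> \<in> cyclic_cocycles scale S \<rho> 2 \<longleftrightarrow> \<phi> \<in> cyclic_cochains scale S \<rho> 2 \<and>
    (\<forall>w\<in>S. \<forall>x\<in>S. \<forall>y\<in>S. \<forall>z\<in>S.
      \<phi> [w * x, y, z] - \<phi> [w, x * y, z] + \<phi> [w, x, y * z] - \<phi> [\<rho> z * w, x, y] = 0)"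
proof -
  have "tuples S (2 + 1) = tuples S 3" by simp
  then show ?thesis
    unfolding cyclic_cocycles_def mem_Collect_eq by (simp only: ball_tuples twisted_coboundary_simps)
qed

lemma lin_combine: "lin f \<Longrightarrow> lin g \<Longrightarrow> lin (\<lambda>x. f x + k * g x)"
  by (simp add: linear_functional_on_def algebra_simps)

lemma cyclic_cochains_combine:
  "\<phi> \<in> cyclic_cochains scale S \<rho> n \<Longrightarrow> \<psi> \<in> cyclic_cochains scale S \<rho> n \<Longrightarrow>
    (\<lambda>as. \<phi> as + k * \<psi> as) \<in> cyclic_cochains scale S \<rho> n"
  unfolding cyclic_cochains_def multilinear_on_def
  by (simp add: lin_combine) (simp add: algebra_simps)

lemma twisted_coboundary_combine:
  "twisted_coboundary \<rho> n (\<lambda>as. \<phi> as + k * \<psi> as) as =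
    twisted_coboundary \<rho> n \<phi> as + k * twisted_coboundary \<rho> n \<psi> as"
  by (simp add: twisted_coboundary_def algebra_simps sum.distrib sum_distrib_left)

lemma cyclic_cocycles_2_combine:
  assumes "\<phi> \<in> cyclic_cocycles scale S \<rho> 2" "\<psi> \<in> cyclic_cocycles scale S \<rho> 2" "\<forall>x\<in>S. \<rho> x \<in> S"
    and "\<And>x y z. x \<in> S \<Longrightarrow> y \<in> S \<Longrightarrow> z \<in> S \<Longrightarrow> \<chi> [x, y, z] = \<phi> [x, y, z] + k * \<psi> [x, y, z]"
  shows "\<chi> \<in> cyclic_cocycles scale S \<rho> 2"
proof -
  have "(\<lambda>as. \<phi> as + k * \<psi> as) \<in> cyclic_cocycles scale S \<rho> 2"
    using assms(1,2) cyclic_cochains_combine[of \<phi> \<rho> 2 \<psi> k] twisted_coboundary_combine[of \<rho> 2 \<phi> k \<psi>]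
    by (simp add: cyclic_cocycles_def)
  moreover have "\<chi> \<in> cyclic_cocycles scale S \<rho> 2 \<longleftrightarrow>
      (\<lambda>as. \<phi> as + k * \<psi> as) \<in> cyclic_cocycles scale S \<rho> 2"
    unfolding cyclic_cocycles_2 cyclic_cochains_2 linear_functional_on_def
    by (simp add: assms(4) bspec[OF assms(3)] cong: ball_cong)
  ultimately show ?thesis by simp
qed

text \<open>The case \<open>n = 1\<close> of the fact that \<open>b\<^sub>\<sigma>\<close> maps cyclic cochains to cyclic cochains and squares to \<open>0\<close>.\<close>

lemma cyclic_coboundary_is_cocycle:
  assumes \<theta>: "\<theta> \<in> cyclic_cochains scale S \<rho> 1" and \<rho>: "twist \<mu> \<rho>"
  shows "twisted_coboundary \<rho> 1 \<theta> \<in> cyclic_cocycles scale S \<rho> 2"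
proof -
  have lin: "lin (\<lambda>y. \<theta> [x, y])" "lin (\<lambda>y. \<theta> [y, x])" if "x \<in> S" for x
    using \<theta> that unfolding cyclic_cochains_1 by blast+
  have cyc: "\<theta> [\<rho> y, x] = - \<theta> [x, y]" if "x \<in> S" "y \<in> S" for x y
    using \<theta> that unfolding cyclic_cochains_1 by simp
  note \<theta>_simps = functional_simps(1,2)[OF lin(1)] functional_simps(1,2)[OF lin(2)]
  have \<rho>_simps: "x \<in> S \<Longrightarrow> \<rho> x \<in> S" "x \<in> S \<Longrightarrow> y \<in> S \<Longrightarrow> \<rho> (x + y) = \<rho> x + \<rho> y"
    "x \<in> S \<Longrightarrow> y \<in> S \<Longrightarrow> \<rho> (x * y) = \<rho> x * \<rho> y" "x \<in> S \<Longrightarrow> \<rho> (k *s x) = k *s \<rho> x" for x y k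
    using \<rho> by (simp_all add: twist_def)
  show ?thesis
    unfolding cyclic_cocycles_2 cyclic_cochains_2 linear_functional_on_def
  proof (intro conjI ballI allI)
    fix x y z assume "x \<in> S" "y \<in> S" "z \<in> S"
    then show "twisted_coboundary \<rho> 1 \<theta> [x, y, z] = twisted_coboundary \<rho> 1 \<theta> [\<rho> z, x, y]"
      using cyc[of "x * y" z] cyc[of x "y * z"] by (simp add: twisted_coboundary_simps[simplified] \<rho>_simps)
  next
    fix w x y z assume "w \<in> S" "x \<in> S" "y \<in> S" "z \<in> S"
    then show "twisted_coboundary \<rho> 1 \<theta> [w * x, y, z] - twisted_coboundary \<rho> 1 \<theta> [w, x * y, z] +
        twisted_coboundary \<rho> 1 \<theta> [w, x, y * z] - twisted_coboundary \<rho> 1 \<theta> [\<rho> z * w, x, y] = 0"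
      by (simp add: twisted_coboundary_simps[simplified] \<rho>_simps mult.assoc)
  qed (simp_all add: twisted_coboundary_simps[simplified] \<rho>_simps \<theta>_simps distrib_left distrib_right
      scale_mult_left scale_mult_right algebra_simps)
qed

lemma periodicity_is_cocycle:
  assumes T: "lin T" and tr: "\<And>x y. x \<in> S \<Longrightarrow> y \<in> S \<Longrightarrow> T (x * y) = T (\<rho> y * x)" and \<rho>: "\<forall>x\<in>S. \<rho> x \<in> S"
  shows "periodicity (cochain0 T) \<in> cyclic_cocycles scale S \<rho> 2"
  unfolding cyclic_cocycles_2 cyclic_cochains_2 linear_functional_on_def
proof (intro conjI ballI allI)
  fix x y z assume "x \<in> S" "y \<in> S" "z \<in> S"
  then show "periodicity (cochain0 T) [x, y, z] = periodicity (cochain0 T) [\<rho> z, x, y]"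
    using tr[of "x * y" z] by (simp add: periodicity_def cochain0_def mult.assoc)
next
  fix w x y z assume "w \<in> S" "x \<in> S" "y \<in> S" "z \<in> S"
  then show "periodicity (cochain0 T) [w * x, y, z] - periodicity (cochain0 T) [w, x * y, z] +
      periodicity (cochain0 T) [w, x, y * z] - periodicity (cochain0 T) [\<rho> z * w, x, y] = 0"
    using tr[of "w * x * y" z] by (simp add: periodicity_def cochain0_def mult.assoc)
qed (simp_all add: periodicity_def cochain0_def functional_simps[OF T] distrib_left distrib_right
      scale_mult_left scale_mult_right algebra_simps)

text \<open>The coboundaries form a subspace, so adding multiples of \<open>b\<^sub>\<rho> \<theta>\<close> does not affect being cohomologous to
a given cocycle.\<close>

lemma HC_class_eqI:
  assumes m: "m = Suc n"
    and cocycles: "\<phi> \<in> cyclic_cocycles scale S \<rho> m" "\<psi> \<in> cyclic_cocycles scale S \<rho> m"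
    and \<theta>: "\<theta> \<in> cyclic_cochains scale S \<rho> n"
    and diff: "\<And>as. as \<in> tuples S m \<Longrightarrow> \<phi> as - \<psi> as = twisted_coboundary \<rho> n \<theta> as"
  shows "HC_class scale S \<rho> m \<phi> = HC_class scale S \<rho> m \<psi>"
proof -
  have shift: "(\<lambda>as. \<phi>2 as - \<chi> as) \<in> cyclic_coboundaries scale S \<rho> m"
    if cob: "(\<lambda>as. \<phi>1 as - \<chi> as) \<in> cyclic_coboundaries scale S \<rho> m"
      and k: "\<And>as. as \<in> tuples S m \<Longrightarrow> \<phi>2 as - \<phi>1 as = k * twisted_coboundary \<rho> n \<theta> as" for \<phi>1 \<phi>2 \<chi> k
  proof -
    obtain \<eta> where \<eta>: "\<eta> \<in> cyclic_cochains scale S \<rho> n"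
      "\<And>as. as \<in> tuples S m \<Longrightarrow> \<phi>1 as - \<chi> as = twisted_coboundary \<rho> n \<eta> as"
      using cob by (auto simp: cyclic_coboundaries_def m)
    have "\<phi>2 as - \<chi> as = twisted_coboundary \<rho> n (\<lambda>as. \<eta> as + k * \<theta> as) as" if "as \<in> tuples S m" for as
      unfolding twisted_coboundary_combine
      using \<eta>(2)[OF that] k[OF that]
      by (simp add: algebra_simps)
    then show ?thesis
      using cyclic_cochains_combine[OF \<eta>(1) \<theta>, of k] by (auto simp: cyclic_coboundaries_def m)
  qed
  show ?thesis
    unfolding HC_class_def cohomologous_def
    using cocycles shift[of \<phi> _ \<psi> "-1"] shift[of \<psi> _ \<phi> 1] diff
    by (auto simp: minus_diff_eq) (metis minus_diff_eq)+
qed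

end

section \<open>The class of \<open>\<tau>\<close>\<close>

context podles_twisted
begin

text \<open>The cyclicity of \<open>\<theta>\<close> is \<open>\<psi>_symmetrised\<close> together with \<open>\<phi> = 2 \<beta> h\<^sub>A\<close>: the two copies of \<open>\<beta> h\<^sub>A(x y)\<close> that
\<open>\<theta>(x, y) + \<theta>(\<sigma>(y), x)\<close> subtracts are equal since \<open>h\<^sub>A\<close> is a twisted trace.\<close>

lemma podles_tau_class:
  "podles_tau scale q act h \<in> cyclic_cocycles scale S \<sigma> 2" (is "?\<tau> \<in> _")
  "cochain0 hA \<in> cyclic_cocycles scale S \<sigma> 0"
  "periodicity (cochain0 hA) \<in> cyclic_cocycles scale S \<sigma> 2"
  "HC_class scale S \<sigma> 2 (podles_tau scale q act h) =
    HC_class scale S \<sigma> 2 (\<lambda>as. \<beta> * periodicity (cochain0 hA) as)"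
proof -
  let ?P = "periodicity (cochain0 hA)"
  define \<theta> where "\<theta> as = \<psi> (as ! 0) (as ! 1) - \<beta> * hA (as ! 0 * as ! 1)" for as
  have \<theta>: "\<theta> \<in> cyclic_cochains scale S \<sigma> 1"
    unfolding cyclic_cochains_1 linear_functional_on_def
  proof (intro conjI ballI allI)
    fix x y assume "x \<in> S" "y \<in> S"
    then show "\<theta> [x, y] = - \<theta> [\<sigma> y, x]"
      using \<psi>_symmetrised[of x y] \<phi>_eq[of "x * y"] hA_twisted[of x y] by (simp add: \<theta>_def algebra_simps)
  qed (simp_all add: \<theta>_def \<psi>_add \<psi>_scale functional_simps[OF hA_functional] distrib_left distrib_right
      scale_mult_left scale_mult_right algebra_simps)
  have b\<theta>: "twisted_coboundary \<sigma> 1 \<theta> [x, y, z] = ?\<tau> [x, y, z] - \<beta> * ?P [x, y, z]"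
    if "x \<in> S" "y \<in> S" "z \<in> S" for x y z
    using coboundary_\<psi>[OF that] hA_twisted[of "x * y" z] that
    by (simp add: twisted_coboundary_simps[simplified] \<theta>_def podles_tau_def periodicity_def cochain0_def mult.assoc algebra_simps)
  have hA_eval: "cochain0 hA [x] = hA x" for x by (simp add: cochain0_def)
  have "hA x = hA (\<sigma> x)" if "x \<in> S" for x using hA_twisted[OF S_1 that] by simp
  then show "cochain0 hA \<in> cyclic_cocycles scale S \<sigma> 0"
    unfolding cyclic_cocycles_0 cyclic_cochains_0 hA_eval using hA_functional hA_twisted by blast
  show P: "?P \<in> cyclic_cocycles scale S \<sigma> 2"
    using periodicity_is_cocycle[OF hA_functional, of \<sigma>] hA_twisted by simp
  have b: "twisted_coboundary \<sigma> 1 \<theta> \<in> cyclic_cocycles scale S \<sigma> 2"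
    by (rule cyclic_coboundary_is_cocycle[OF \<theta> twist_sigma])
  show \<tau>: "?\<tau> \<in> cyclic_cocycles scale S \<sigma> 2"
    by (rule cyclic_cocycles_2_combine[OF b P, where k = \<beta>]) (simp, simp only: b\<theta> diff_add_cancel)
  have \<beta>P: "(\<lambda>as. \<beta> * ?P as) \<in> cyclic_cocycles scale S \<sigma> 2"
    by (rule cyclic_cocycles_2_combine[OF P P, where k = "\<beta> - 1"]) (simp_all add: algebra_simps)
  show "HC_class scale S \<sigma> 2 ?\<tau> = HC_class scale S \<sigma> 2 (\<lambda>as. \<beta> * ?P as)"
  proof (rule HC_class_eqI[OF _ \<tau> \<beta>P \<theta>])
    fix as assume "as \<in> tuples S 2"
    then show "?\<tau> as - \<beta> * ?P as = twisted_coboundary \<sigma> 1 \<theta> as"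
      unfolding tuples_simps by (auto simp only: b\<theta>)
  qed simp
qed

end

theorem theorem6p2:
  fixes scale :: "complex \<Rightarrow> 'a::ring_1 \<Rightarrow> 'a" and q :: real
    and star :: "'a \<Rightarrow> 'a" and a c :: 'a
    and act :: "uq_gen \<Rightarrow> 'a \<Rightarrow> 'a" and h :: "'a \<Rightarrow> complex"
    and \<sigma> :: "'a \<Rightarrow> 'a" and hA :: "'a \<Rightarrow> complex"
    and S :: "'a set" and \<tau> :: "'a list \<Rightarrow> complex"
  assumes "quantum_SU2 scale q star a c"
    and "Uq_right_action scale q star a c act"
    and "haar_state scale q star a c h"
    and "is_podles_sigma scale q star a c \<sigma>"
    and "is_podles_hA scale q star a c hA"
    and "S = podles_algebra scale star a c"
    and "\<tau> = podles_tau scale q act h"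
  shows "\<tau> \<in> cyclic_cocycles scale S \<sigma> 2 \<and>
    cochain0 hA \<in> cyclic_cocycles scale S \<sigma> 0 \<and>
    periodicity (cochain0 hA) \<in> cyclic_cocycles scale S \<sigma> 2 \<and>
    (\<exists>\<beta>::complex. \<beta> \<noteq> 0 \<and>
      HC_class scale S \<sigma> 2 \<tau> = HC_class scale S \<sigma> 2 (\<lambda>as. \<beta> * periodicity (cochain0 hA) as))"
proof -
  interpret podles_twisted scale q star a c act h \<sigma> hA
    using assms by (intro podles_twisted.intro podles_haar.intro podles_twisted_axioms.intro)
  show ?thesis unfolding assms(6,7) using podles_tau_class \<beta>_neq_0 by blast
qed

end
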